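(* Let $n\in\mathbb{N}$, $\Omega=[0,1]^n$ with Lebesgue measure, and let $p:\Omega\to[1,\infty)$ be a measurable function. Let $W(p)$ be the set of all functions on $\Omega$ equimeasurable with $p$. There exists $\bar p\in W(p)$ for which the space $C(\Omega)$ of continuous functions is a closed subspace of $L^{\bar p(\cdot)}(\Omega)$ if and only if $$\limsup_{t\to0+}\frac{p^*(t)}{\ln(e/t)}>0.$$
   Context: $|E|$ denotes the Lebesgue measure of a measurable set $E$. The decreasing rearrangement of a measurable function $f$ on $\Omega$ is $$f^*(s)=\inf\{\alpha\ge0: |\{x\in\Omega:|f(x)|>\alpha\}|\le s\},\quad s>0.$$ Two functions $p,\bar p:\Omega\to[1,\infty)$ are equimeasurable if $|\{x\in\Omega: p(x)>\alpha\}|=|\{x\in\Omega:\bar p(x)>\alpha\}|$ for all $\alpha\ge0$. For a measurable $r:\Omega\to[1,\infty)$, the variable exponent Lebesgue space $L^{r(\cdot)}(\Omega)$ is the set of all (equivalence classes of) real-valued measurable functions $f$ on $\Omega$ such that $\int_\Omega(|f(x)|/\lambda)^{r(x)}\,dx<\infty$ for some $\lambda>0$, with norm $\|f\|_{r(\cdot)}=\inf\{\lambda>0:\int_\Omega(|f(x)|/\lambda)^{r(x)}\,dx\le1\}$; it is a Banach space. $C(\Omega)$ is the space of real-valued continuous functions on $\Omega$, and "closed subspace" means that $C(\Omega)$ is a linear subspace of $L^{\bar p(\cdot)}(\Omega)$ that is closed in the norm $\|\cdot\|_{\bar p(\cdot)}$. *)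

theory Defs
  imports "HOL-Analysis.Analysis"
begin

definition decreasing_rearrangement :: "'a measure \<Rightarrow> ('a \<Rightarrow> real) \<Rightarrow> real \<Rightarrow> real" where
  "decreasing_rearrangement M f s =
     Inf {\<alpha>. 0 \<le> \<alpha> \<and> emeasure M {x \<in> space M. \<bar>f x\<bar> > \<alpha>} \<le> ennreal s}"

text \<open>Exponents are measurable and take values in \<open>[1, \<infinity>)\<close>; only their values on
  \<^term>\<open>space M\<close> matter.\<close>

definition exponents :: "'a measure \<Rightarrow> ('a \<Rightarrow> real) set" where
  "exponents M = {r \<in> borel_measurable M. \<forall>x\<in>space M. 1 \<le> r x}"

definition equimeasurable :: "'a measure \<Rightarrow> ('a \<Rightarrow> real) \<Rightarrow> ('a \<Rightarrow> real) \<Rightarrow> bool" where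
  "equimeasurable M p q \<longleftrightarrow>
     (\<forall>\<alpha>\<ge>0. emeasure M {x \<in> space M. p x > \<alpha>} = emeasure M {x \<in> space M. q x > \<alpha>})"

definition equimeasurable_class :: "'a measure \<Rightarrow> ('a \<Rightarrow> real) \<Rightarrow> ('a \<Rightarrow> real) set" where
  "equimeasurable_class M p = {q \<in> exponents M. equimeasurable M p q}"

definition var_modular :: "'a measure \<Rightarrow> ('a \<Rightarrow> real) \<Rightarrow> ('a \<Rightarrow> real) \<Rightarrow> ennreal" where
  "var_modular M r f = (\<integral>\<^sup>+ x. ennreal (\<bar>f x\<bar> powr r x) \<partial>M)"

definition var_Lfun :: "'a measure \<Rightarrow> ('a \<Rightarrow> real) \<Rightarrow> ('a \<Rightarrow> real) set" where
  "var_Lfun M r = {f \<in> borel_measurable M. \<exists>k>0. var_modular M r (\<lambda>x. f x / k) < \<infinity>}"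

definition luxemburg :: "'a measure \<Rightarrow> ('a \<Rightarrow> real) \<Rightarrow> ('a \<Rightarrow> real) \<Rightarrow> real" where
  "luxemburg M r f = Inf {k. 0 < k \<and> var_modular M r (\<lambda>x. f x / k) \<le> 1}"

text \<open>Almost-everywhere equality classes of measurable functions, with the induced operations.
  The variable exponent Lebesgue space is a set of such classes; the lemmas below show that the
  operations and the norm do not depend on representatives.\<close>

definition ae_class :: "'a measure \<Rightarrow> ('a \<Rightarrow> real) \<Rightarrow> ('a \<Rightarrow> real) set" where
  "ae_class M f = {g \<in> borel_measurable M. AE x in M. g x = f x}"

definition class_add ::
    "'a measure \<Rightarrow> ('a \<Rightarrow> real) set \<Rightarrow> ('a \<Rightarrow> real) set \<Rightarrow> ('a \<Rightarrow> real) set" where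
  "class_add M F G = (\<Union>f\<in>F. \<Union>g\<in>G. ae_class M (\<lambda>x. f x + g x))"

definition class_scale ::
    "'a measure \<Rightarrow> real \<Rightarrow> ('a \<Rightarrow> real) set \<Rightarrow> ('a \<Rightarrow> real) set" where
  "class_scale M c F = (\<Union>f\<in>F. ae_class M (\<lambda>x. c * f x))"

definition var_L :: "'a measure \<Rightarrow> ('a \<Rightarrow> real) \<Rightarrow> ('a \<Rightarrow> real) set set" where
  "var_L M r = ae_class M ` var_Lfun M r"

definition var_L_norm :: "'a measure \<Rightarrow> ('a \<Rightarrow> real) \<Rightarrow> ('a \<Rightarrow> real) set \<Rightarrow> real" where
  "var_L_norm M r F = the_elem (luxemburg M r ` F)"

text \<open>The distance \<open>\<parallel>F - G\<parallel>\<close>. The value \<open>0\<close> outside the space is irrelevant; it is there because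
  \<^locale>\<open>Metric_space\<close> requires nonnegativity and symmetry for arbitrary arguments.\<close>

definition var_L_dist ::
    "'a measure \<Rightarrow> ('a \<Rightarrow> real) \<Rightarrow> ('a \<Rightarrow> real) set \<Rightarrow> ('a \<Rightarrow> real) set \<Rightarrow> real" where
  "var_L_dist M r F G =
     (if F \<in> var_L M r \<and> G \<in> var_L M r
      then var_L_norm M r (class_add M F (class_scale M (-1) G)) else 0)"

definition closed_subspace_var_L ::
    "'a measure \<Rightarrow> ('a \<Rightarrow> real) \<Rightarrow> ('a \<Rightarrow> real) set set \<Rightarrow> bool" where
  "closed_subspace_var_L M r S \<longleftrightarrow>
     S \<subseteq> var_L M r \<and>
     ae_class M (\<lambda>x. 0) \<in> S \<and>
     (\<forall>F\<in>S. \<forall>G\<in>S. class_add M F G \<in> S) \<and>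
     (\<forall>c. \<forall>F\<in>S. class_scale M c F \<in> S) \<and>
     closedin (Metric_space.mtopology (var_L M r) (var_L_dist M r)) S"

text \<open>The space \<open>C(\<Omega>)\<close>, regarded as a set of classes for Lebesgue measure on \<open>\<Omega>\<close>.\<close>

definition continuous_classes :: "'a::euclidean_space set \<Rightarrow> ('a \<Rightarrow> real) set set" where
  "continuous_classes \<Omega> = ae_class (lebesgue_on \<Omega>) ` {f. continuous_on \<Omega> f}"

definition unit_cube :: "(real ^ 'n) set" where
  "unit_cube = {x. \<forall>i. 0 \<le> x $ i \<and> x $ i \<le> 1}"

lemma unit_cube_eq_cbox: "unit_cube = cbox 0 1"
  by (auto simp: unit_cube_def mem_box_cart)

lemma ae_class_cong:
  assumes "AE x in M. f x = g x"
  shows "ae_class M f = ae_class M g"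
proof -
  have "(AE x in M. h x = f x) \<longleftrightarrow> (AE x in M. h x = g x)" for h
  proof
    show "AE x in M. h x = g x" if "AE x in M. h x = f x"
      using that assms by eventually_elim auto
    show "AE x in M. h x = f x" if "AE x in M. h x = g x"
      using that assms by eventually_elim auto
  qed
  then show ?thesis by (auto simp: ae_class_def)
qed

lemma ae_class_self: "f \<in> borel_measurable M \<Longrightarrow> f \<in> ae_class M f"
  by (simp add: ae_class_def)

lemma ae_class_eq_iff:
  assumes "f \<in> borel_measurable M"
  shows "ae_class M f = ae_class M g \<longleftrightarrow> (AE x in M. f x = g x)"
proof
  show "AE x in M. f x = g x" if "ae_class M f = ae_class M g"
    using ae_class_self[OF assms] that by (auto simp: ae_class_def)
qed (rule ae_class_cong)

lemma class_add_ae_class: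
  assumes "f \<in> borel_measurable M" "g \<in> borel_measurable M"
  shows "class_add M (ae_class M f) (ae_class M g) = ae_class M (\<lambda>x. f x + g x)"
proof -
  have "ae_class M (\<lambda>x. f' x + g' x) = ae_class M (\<lambda>x. f x + g x)"
    if "f' \<in> ae_class M f" "g' \<in> ae_class M g" for f' g'
  proof (rule ae_class_cong)
    have "AE x in M. f' x = f x" "AE x in M. g' x = g x"
      using that by (auto simp: ae_class_def)
    then show "AE x in M. f' x + g' x = f x + g x" by eventually_elim auto
  qed
  then show ?thesis
    using ae_class_self[OF assms(1)] ae_class_self[OF assms(2)] unfolding class_add_def by blast
qed

lemma class_scale_ae_class:
  assumes "f \<in> borel_measurable M"
  shows "class_scale M c (ae_class M f) = ae_class M (\<lambda>x. c * f x)"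
proof -
  have "ae_class M (\<lambda>x. c * f' x) = ae_class M (\<lambda>x. c * f x)" if "f' \<in> ae_class M f" for f'
  proof (rule ae_class_cong)
    have "AE x in M. f' x = f x" using that by (auto simp: ae_class_def)
    then show "AE x in M. c * f' x = c * f x" by eventually_elim auto
  qed
  then show ?thesis
    using ae_class_self[OF assms(1)] unfolding class_scale_def by blast
qed

lemma var_modular_cong:
  assumes "AE x in M. f x = g x"
  shows "var_modular M r f = var_modular M r g"
  unfolding var_modular_def by (rule nn_integral_cong_AE) (use assms in \<open>eventually_elim, auto\<close>)

lemma luxemburg_cong:
  assumes "AE x in M. f x = g x"
  shows "luxemburg M r f = luxemburg M r g"
proof -
  have "var_modular M r (\<lambda>x. f x / k) = var_modular M r (\<lambda>x. g x / k)" for k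
    by (rule var_modular_cong) (use assms in \<open>eventually_elim, auto\<close>)
  then show ?thesis by (simp add: luxemburg_def)
qed

lemma var_L_norm_ae_class:
  assumes "f \<in> borel_measurable M"
  shows "var_L_norm M r (ae_class M f) = luxemburg M r f"
proof -
  have "luxemburg M r g = luxemburg M r f" if "g \<in> ae_class M f" for g
    using that by (intro luxemburg_cong) (simp add: ae_class_def)
  then have "luxemburg M r ` ae_class M f = {luxemburg M r f}"
    using ae_class_self[OF assms] by blast
  then show ?thesis by (simp add: var_L_norm_def)
qed

lemma var_L_dist_ae_class:
  assumes "f \<in> var_Lfun M r" "g \<in> var_Lfun M r"
  shows "var_L_dist M r (ae_class M f) (ae_class M g) = luxemburg M r (\<lambda>x. f x - g x)"
proof -
  have [measurable]: "f \<in> borel_measurable M" "g \<in> borel_measurable M"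
    using assms by (auto simp: var_Lfun_def)
  have "ae_class M f \<in> var_L M r" "ae_class M g \<in> var_L M r"
    using assms by (auto simp: var_L_def)
  then show ?thesis
    by (simp add: var_L_dist_def class_scale_ae_class class_add_ae_class var_L_norm_ae_class)
qed

lemma powr_le_scale:
  fixes a c q :: real
  assumes "0 \<le> a" "0 \<le> c" "c \<le> 1" "1 \<le> q"
  shows "(c * a) powr q \<le> c * a powr q"
proof (cases "c = 0")
  case False
  have "c powr q \<le> c powr 1" using assms False by (intro powr_mono') auto
  then show ?thesis using assms by (simp add: powr_mult mult_right_mono)
qed (use assms in simp)

lemma powr_convex_combination:
  fixes a b c q :: real
  assumes "0 \<le> a" "0 \<le> b" "0 \<le> c" "c \<le> 1" "1 \<le> q"
  shows "((1 - c) * a + c * b) powr q \<le> (1 - c) * a powr q + c * b powr q"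
proof (cases "a = 0 \<or> b = 0")
  case True
  then show ?thesis
    using powr_le_scale[of b c q] powr_le_scale[of a "1 - c" q] assms by auto
next
  case False
  have "convex_on {0<..} (\<lambda>x::real. x powr q)" using assms by (intro powr_convex)
  from convex_onD[OF this, of c a b] show ?thesis using assms False by simp
qed

lemma var_Lfun_measurable: "f \<in> var_Lfun M r \<Longrightarrow> f \<in> borel_measurable M"
  by (simp add: var_Lfun_def)

context
  fixes M :: "'a measure" and r :: "'a \<Rightarrow> real"
  assumes exponent: "r \<in> exponents M"
begin

lemma exponent_measurable [measurable]: "r \<in> borel_measurable M"
  using exponent by (simp add: exponents_def)

lemma exponent_ge1: "x \<in> space M \<Longrightarrow> 1 \<le> r x"
  using exponent by (simp add: exponents_def)

lemma var_modular_scale: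
  assumes [measurable]: "f \<in> borel_measurable M" and "0 \<le> c" "c \<le> 1"
  shows "var_modular M r (\<lambda>x. c * f x) \<le> ennreal c * var_modular M r f"
proof -
  have "var_modular M r (\<lambda>x. c * f x) \<le> (\<integral>\<^sup>+ x. ennreal c * ennreal (\<bar>f x\<bar> powr r x) \<partial>M)"
    unfolding var_modular_def
    using powr_le_scale[of "\<bar>f x\<bar>" c "r x" for x] assms exponent_ge1
    by (intro nn_integral_mono) (auto simp: abs_mult ennreal_mult[symmetric] intro!: ennreal_leI)
  also have "\<dots> = ennreal c * var_modular M r f"
    unfolding var_modular_def by (rule nn_integral_cmult) measurable
  finally show ?thesis .
qed

lemma var_modular_add:
  assumes [measurable]: "f \<in> borel_measurable M" "g \<in> borel_measurable M"
    and ab: "0 < a" "0 < b"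
    and 1: "var_modular M r (\<lambda>x. f x / a) \<le> 1" "var_modular M r (\<lambda>x. g x / b) \<le> 1"
  shows "var_modular M r (\<lambda>x. (f x + g x) / (a + b)) \<le> 1"
proof -
  define c where "c = b / (a + b)"
  have c: "0 \<le> c" "c \<le> 1" "1 - c = a / (a + b)" using ab by (auto simp: c_def field_simps)
  have *: "\<bar>(f x + g x) / (a + b)\<bar> powr r x
      \<le> (1 - c) * \<bar>f x / a\<bar> powr r x + c * \<bar>g x / b\<bar> powr r x" if "x \<in> space M" for x
  proof -
    have "\<bar>(f x + g x) / (a + b)\<bar> \<le> (1 - c) * \<bar>f x / a\<bar> + c * \<bar>g x / b\<bar>"
      unfolding c(3) using ab by (simp add: c_def abs_divide divide_right_mono add_divide_distrib[symmetric])
    then have "\<bar>(f x + g x) / (a + b)\<bar> powr r x \<le> ((1 - c) * \<bar>f x / a\<bar> + c * \<bar>g x / b\<bar>) powr r x"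
      using exponent_ge1[OF that] by (intro powr_mono2) auto
    also have "\<dots> \<le> (1 - c) * \<bar>f x / a\<bar> powr r x + c * \<bar>g x / b\<bar> powr r x"
      using c exponent_ge1[OF that] by (intro powr_convex_combination) auto
    finally show ?thesis .
  qed
  have "var_modular M r (\<lambda>x. (f x + g x) / (a + b))
      \<le> (\<integral>\<^sup>+ x. ennreal (1 - c) * ennreal (\<bar>f x / a\<bar> powr r x)
              + ennreal c * ennreal (\<bar>g x / b\<bar> powr r x) \<partial>M)"
    unfolding var_modular_def using * c(1,2)
    by (intro nn_integral_mono) (simp add: ennreal_mult[symmetric] ennreal_plus[symmetric] ennreal_leI
        del: ennreal_plus)
  also have "\<dots> = ennreal (1 - c) * var_modular M r (\<lambda>x. f x / a)
      + ennreal c * var_modular M r (\<lambda>x. g x / b)"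
    unfolding var_modular_def by (simp add: nn_integral_add nn_integral_cmult)
  also have "\<dots> \<le> ennreal (1 - c) * 1 + ennreal c * 1"
    using 1 by (intro add_mono mult_left_mono) auto
  also have "\<dots> = 1" using c(1,2) by (simp add: ennreal_plus[symmetric] del: ennreal_plus)
  finally show ?thesis .
qed

lemma var_Lfun_unit:
  assumes "f \<in> var_Lfun M r"
  obtains a where "0 < a" "var_modular M r (\<lambda>x. f x / a) \<le> 1"
proof -
  have [measurable]: "f \<in> borel_measurable M" using assms by (rule var_Lfun_measurable)
  from assms obtain l where l: "0 < l" "var_modular M r (\<lambda>x. f x / l) < \<infinity>"
    by (auto simp: var_Lfun_def)
  then obtain m where m: "0 \<le> m" "var_modular M r (\<lambda>x. f x / l) = ennreal m"
    by (cases "var_modular M r (\<lambda>x. f x / l)") auto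
  define c where "c = 1 / (1 + m)"
  have c: "0 < c" "c \<le> 1" "c * m \<le> 1" using m by (auto simp: c_def field_simps)
  have "var_modular M r (\<lambda>x. c * (f x / l)) \<le> ennreal c * ennreal m"
    using var_modular_scale[of "\<lambda>x. f x / l" c] c m by auto
  also have "\<dots> \<le> 1" using c m by (simp add: ennreal_mult[symmetric])
  finally have "var_modular M r (\<lambda>x. f x / (l / c)) \<le> 1" by (simp add: mult.commute)
  then show thesis using that[of "l / c"] l c by simp
qed

lemma luxemburg_le:
  assumes "0 < a" "var_modular M r (\<lambda>x. f x / a) \<le> 1"
  shows "luxemburg M r f \<le> a"
  unfolding luxemburg_def using assms by (intro cInf_lower bdd_belowI[of _ 0]) auto

lemma luxemburg_less:
  assumes "f \<in> var_Lfun M r" "luxemburg M r f < e"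
  obtains a where "0 < a" "a < e" "var_modular M r (\<lambda>x. f x / a) \<le> 1"
proof -
  obtain b where "0 < b" "var_modular M r (\<lambda>x. f x / b) \<le> 1"
    using var_Lfun_unit[OF assms(1)] .
  then have "{k. 0 < k \<and> var_modular M r (\<lambda>x. f x / k) \<le> 1} \<noteq> {}" by auto
  then obtain a where "a \<in> {k. 0 < k \<and> var_modular M r (\<lambda>x. f x / k) \<le> 1}" "a < e"
    using cInf_lessD[OF _ assms(2)[unfolded luxemburg_def]] by auto
  then show thesis using that by auto
qed

lemma luxemburg_nonneg:
  assumes "f \<in> var_Lfun M r" shows "0 \<le> luxemburg M r f"
proof (rule ccontr)
  assume "\<not> ?thesis"
  then obtain a where "0 < a" "a < (0::real)" using luxemburg_less[OF assms, of 0] by auto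
  then show False by simp
qed

lemma var_Lfun_add:
  assumes "f \<in> var_Lfun M r" "g \<in> var_Lfun M r"
  shows "(\<lambda>x. f x + g x) \<in> var_Lfun M r"
proof -
  have [measurable]: "f \<in> borel_measurable M" "g \<in> borel_measurable M"
    using assms by (auto intro: var_Lfun_measurable)
  obtain a where a: "0 < a" "var_modular M r (\<lambda>x. f x / a) \<le> 1" using var_Lfun_unit[OF assms(1)] .
  obtain b where b: "0 < b" "var_modular M r (\<lambda>x. g x / b) \<le> 1" using var_Lfun_unit[OF assms(2)] .
  have "var_modular M r (\<lambda>x. (f x + g x) / (a + b)) \<le> 1" using a b by (intro var_modular_add) auto
  then have "var_modular M r (\<lambda>x. (f x + g x) / (a + b)) < \<infinity>" by (rule le_less_trans) simp
  moreover have "0 < a + b" using a b by simp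
  ultimately show ?thesis unfolding var_Lfun_def by auto
qed

lemma luxemburg_triangle:
  assumes "f \<in> var_Lfun M r" "g \<in> var_Lfun M r"
  shows "luxemburg M r (\<lambda>x. f x + g x) \<le> luxemburg M r f + luxemburg M r g"
proof (rule field_le_epsilon)
  fix e :: real assume e: "0 < e"
  obtain a where a: "0 < a" "a < luxemburg M r f + e / 2" "var_modular M r (\<lambda>x. f x / a) \<le> 1"
    using luxemburg_less[OF assms(1), of "luxemburg M r f + e / 2"] e by auto
  obtain b where b: "0 < b" "b < luxemburg M r g + e / 2" "var_modular M r (\<lambda>x. g x / b) \<le> 1"
    using luxemburg_less[OF assms(2), of "luxemburg M r g + e / 2"] e by auto
  have "luxemburg M r (\<lambda>x. f x + g x) \<le> a + b"
    using a b assms[THEN var_Lfun_measurable] by (intro luxemburg_le var_modular_add) auto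
  then show "luxemburg M r (\<lambda>x. f x + g x) \<le> luxemburg M r f + luxemburg M r g + e"
    using a b by simp
qed

lemma luxemburg_eq_0_iff:
  assumes "f \<in> var_Lfun M r"
  shows "luxemburg M r f = 0 \<longleftrightarrow> (AE x in M. f x = 0)"
proof
  have [measurable]: "f \<in> borel_measurable M" using assms by (rule var_Lfun_measurable)
  assume 0: "luxemburg M r f = 0"
  have *: "var_modular M r f \<le> 0 + ennreal e" if e: "0 < e" for e
  proof -
    obtain a where a: "0 < a" "a < min e 1" "var_modular M r (\<lambda>x. f x / a) \<le> 1"
      using luxemburg_less[OF assms, of "min e 1"] 0 e by auto
    have "var_modular M r (\<lambda>x. a * (f x / a)) \<le> ennreal a * var_modular M r (\<lambda>x. f x / a)"
      using a by (intro var_modular_scale) auto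
    also have "\<dots> \<le> ennreal a * 1" using a by (intro mult_left_mono) auto
    also have "\<dots> \<le> 0 + ennreal e" using a by (simp add: ennreal_leI)
    finally show ?thesis using a by simp
  qed
  have "var_modular M r f \<le> 0" by (rule ennreal_le_epsilon) (rule *)
  then have "AE x in M. ennreal (\<bar>f x\<bar> powr r x) = 0"
    unfolding var_modular_def by (subst nn_integral_0_iff_AE[symmetric]) auto
  then show "AE x in M. f x = 0" by eventually_elim (auto simp: ennreal_eq_0_iff powr_eq_0_iff)
next
  assume "AE x in M. f x = 0"
  then have "luxemburg M r f = luxemburg M r (\<lambda>x. 0)" by (rule luxemburg_cong)
  also have "\<dots> = Inf {0<..}" by (simp add: luxemburg_def var_modular_def greaterThan_def)
  finally show "luxemburg M r f = 0" by simp
qed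

lemma luxemburg_uminus: "luxemburg M r (\<lambda>x. - f x) = luxemburg M r f"
  by (simp add: luxemburg_def var_modular_def)

lemma var_Lfun_diff:
  assumes "f \<in> var_Lfun M r" "g \<in> var_Lfun M r"
  shows "(\<lambda>x. f x - g x) \<in> var_Lfun M r"
proof -
  have "(\<lambda>x. - g x) \<in> var_Lfun M r"
    using assms(2) by (auto simp: var_Lfun_def var_modular_def)
  from var_Lfun_add[OF assms(1) this] show ?thesis by simp
qed

lemma Metric_space_var_L: "Metric_space (var_L M r) (var_L_dist M r)"
proof
  have minus: "luxemburg M r (\<lambda>x. f x - g x) = luxemburg M r (\<lambda>x. g x - f x)" for f g
    using luxemburg_uminus[of "\<lambda>x. g x - f x"] by simp
  show "var_L_dist M r F G = var_L_dist M r G F" for F G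
  proof (cases "F \<in> var_L M r \<and> G \<in> var_L M r")
    case True
    then obtain f g where "f \<in> var_Lfun M r" "g \<in> var_Lfun M r"
      "F = ae_class M f" "G = ae_class M g" by (auto simp: var_L_def)
    then show ?thesis using minus[of f g] by (simp add: var_L_dist_ae_class)
  qed (auto simp: var_L_dist_def)
  show "0 \<le> var_L_dist M r F G" for F G
  proof (cases "F \<in> var_L M r \<and> G \<in> var_L M r")
    case True
    then obtain f g where "f \<in> var_Lfun M r" "g \<in> var_Lfun M r"
      "F = ae_class M f" "G = ae_class M g" by (auto simp: var_L_def)
    then show ?thesis by (simp add: var_L_dist_ae_class luxemburg_nonneg var_Lfun_diff)
  qed (auto simp: var_L_dist_def)
  show "(var_L_dist M r F G = 0) = (F = G)" if "F \<in> var_L M r" "G \<in> var_L M r" for F G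
  proof -
    from that obtain f g where fg: "f \<in> var_Lfun M r" "g \<in> var_Lfun M r"
      "F = ae_class M f" "G = ae_class M g" by (auto simp: var_L_def)
    then show ?thesis
      by (simp add: var_L_dist_ae_class luxemburg_eq_0_iff var_Lfun_diff ae_class_eq_iff var_Lfun_measurable)
  qed
  show "var_L_dist M r F H \<le> var_L_dist M r F G + var_L_dist M r G H"
    if "F \<in> var_L M r" "G \<in> var_L M r" "H \<in> var_L M r" for F G H
  proof -
    from that obtain f g h where fgh: "f \<in> var_Lfun M r" "g \<in> var_Lfun M r" "h \<in> var_Lfun M r"
      "F = ae_class M f" "G = ae_class M g" "H = ae_class M h" by (auto simp: var_L_def)
    then show ?thesis
      using luxemburg_triangle[OF var_Lfun_diff[of f g] var_Lfun_diff[of g h]] by (simp add: var_L_dist_ae_class)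
  qed
qed

end

end

theory Submission
  imports Defs "HOL-Probability.Distribution_Functions"
begin

text \<open>Write \<open>p\<^sup>*\<close> for the decreasing rearrangement and \<open>\<Omega>\<close> for the cube, and call the upper limit of
  \<open>p\<^sup>* t / ln (e / t)\<close> at \<open>0\<close> the growth of \<open>p\<close>. If it is \<open>0\<close>, all exponentials
  \<open>K powr p\<close> are integrable; if it is positive, \<open>p\<close> can be rearranged to some \<open>q\<close> for which a suitable
  \<open>K powr q\<close> has an integral above \<open>1\<close> over each nonempty open subset of \<open>\<Omega>\<close>.

  Suppose that the growth is \<open>0\<close>. Then the distribution function of \<open>p\<close>, which every \<open>q\<close>
  equimeasurable with \<open>p\<close> shares, decays faster than any exponential, and all \<open>K powr q\<close> are
  integrable (\<open>exponentials_integrable_if_small_rearrangement\<close>). These functions are majorants for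
  the modulars of bounded functions, so bounded pointwise convergence implies convergence in the
  space. Ramps therefore converge to the indicator of a half cube, which is not continuous
  (\<open>not_closed_subspace_var_L_if_exponentials_integrable\<close>).

  Suppose that the growth is positive, say \<open>p\<^sup>* (t j) > c ln (e / t j)\<close> for a rapidly decreasing
  sequence \<open>t j\<close>. For a uniformly distributed \<open>V\<close> on \<open>\<Omega>\<close>, the exponent \<open>q = p\<^sup>* \<circ> V\<close> is equimeasurable
  with \<open>p\<close> and exceeds \<open>c ln (e / t j)\<close> on the set \<open>{V < t j}\<close> of measure \<open>t j\<close>. On this set
  \<open>K powr q\<close> with \<open>K = exp (2 / c)\<close> is at least \<open>(e / t j)\<^sup>2\<close>, so any fixed fraction of the set already
  has a large integral. The heart of the construction is a \<open>V\<close> for which each open set contains a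
  quarter of some \<open>{V < t j}\<close> (\<open>obtain_concentrated_uniform\<close>). With the resulting exponent
  (\<open>obtain_concentrated_exponent\<close>), a continuous function exceeding \<open>K k\<close> at one point has
  norm at least \<open>k\<close>; the norm thus dominates the supremum norm (\<open>dominates_sup_if_concentrated\<close>),
  and closedness follows from completeness under uniform convergence
  (\<open>closed_subspace_var_L_if_dominates_sup\<close>).\<close>

section \<open>Distribution functions and rearrangements\<close>

text \<open>As a measurability rule, \<open>exponent_measurable\<close> applies to every real function and replaces the
  goal by membership in \<^const>\<open>exponents\<close>; this derails the measurability prover.\<close>
declare exponent_measurable [measurable del]

text \<open>The rearrangement is the generalized inverse of the distribution function. The strict form
  of the equivalence needs the infimum to be attained, which is right continuity of
  \<open>\<alpha> \<mapsto> |{\<bar>p\<bar> > \<alpha>}|\<close>; the infimum is over a nonempty set because \<open>p\<close> is finite and \<open>s > 0\<close>.\<close>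
lemma (in finite_measure) less_decreasing_rearrangement_iff:
  assumes [measurable]: "p \<in> borel_measurable M" and s: "0 < s" and \<alpha>: "0 \<le> \<alpha>"
  shows "\<alpha> < decreasing_rearrangement M p s \<longleftrightarrow> s < measure M {x \<in> space M. \<alpha> < \<bar>p x\<bar>}"
proof -
  define m where "m \<alpha> = measure M {x \<in> space M. \<alpha> < \<bar>p x\<bar>}" for \<alpha>
  define A where "A = {\<alpha>. 0 \<le> \<alpha> \<and> m \<alpha> \<le> s}"
  have rearr: "decreasing_rearrangement M p s = Inf A"
    using s by (simp add: decreasing_rearrangement_def A_def m_def emeasure_eq_measure)
  have anti: "m b \<le> m a" if "a \<le> b" for a b
    unfolding m_def using that by (intro finite_measure_mono) auto
  have "(\<lambda>n. m (real n)) \<longlonglongrightarrow> measure M (\<Inter>n. {x \<in> space M. real n < \<bar>p x\<bar>})"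
    unfolding m_def by (rule finite_Lim_measure_decseq) (auto simp: decseq_def)
  also have "(\<Inter>n. {x \<in> space M. real n < \<bar>p x\<bar>}) = {}"
  proof (intro equals0I)
    fix x assume x: "x \<in> (\<Inter>n. {x \<in> space M. real n < \<bar>p x\<bar>})"
    obtain n where "\<bar>p x\<bar> < real n" using reals_Archimedean2 by blast
    moreover have "real n < \<bar>p x\<bar>" using x by blast
    ultimately show False by simp
  qed
  finally have "\<forall>\<^sub>F n in sequentially. m (real n) < s"
    using s by (auto dest: order_tendstoD(2))
  then obtain n where "m (real n) < s" by (auto simp: eventually_sequentially)
  then have ne: "A \<noteq> {}" by (auto simp: A_def intro!: exI[of _ "real n"])
  have bdd: "bdd_below A" by (auto simp: A_def intro: bdd_belowI[of _ 0])
  have "Inf A \<le> \<alpha> \<longleftrightarrow> m \<alpha> \<le> s"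
  proof
    assume "m \<alpha> \<le> s"
    then show "Inf A \<le> \<alpha>" using \<alpha> bdd by (intro cInf_lower) (auto simp: A_def)
  next
    assume le: "Inf A \<le> \<alpha>"
    have m_le: "m (\<alpha> + 1 / real (Suc n)) \<le> s" for n
    proof -
      have "Inf A < \<alpha> + 1 / real (Suc n)" using le by (smt (verit) of_nat_0_less_iff zero_less_Suc zero_less_divide_1_iff)
      then obtain b where "b \<in> A" "b < \<alpha> + 1 / real (Suc n)" using cInf_lessD[OF ne] by blast
      then show ?thesis using anti[of b "\<alpha> + 1 / real (Suc n)"] by (auto simp: A_def)
    qed
    have "(\<lambda>n. m (\<alpha> + 1 / real (Suc n)))
        \<longlonglongrightarrow> measure M (\<Union>n. {x \<in> space M. \<alpha> + 1 / real (Suc n) < \<bar>p x\<bar>})"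
      unfolding m_def
    proof (rule finite_Lim_measure_incseq)
      show "incseq (\<lambda>n. {x \<in> space M. \<alpha> + 1 / real (Suc n) < \<bar>p x\<bar>})"
      proof (rule incseq_SucI, safe)
        fix n x assume "\<alpha> + 1 / real (Suc n) < \<bar>p x\<bar>"
        moreover have "1 / real (Suc (Suc n)) \<le> 1 / real (Suc n)" by (simp add: frac_le)
        ultimately show "\<alpha> + 1 / real (Suc (Suc n)) < \<bar>p x\<bar>" by linarith
      qed
    qed auto
    also have "(\<Union>n. {x \<in> space M. \<alpha> + 1 / real (Suc n) < \<bar>p x\<bar>}) = {x \<in> space M. \<alpha> < \<bar>p x\<bar>}"
    proof safe
      fix x n assume "\<alpha> + 1 / real (Suc n) < \<bar>p x\<bar>"
      moreover have "0 < 1 / real (Suc n)" by simp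
      ultimately show "\<alpha> < \<bar>p x\<bar>" by linarith
    next
      fix x assume x: "x \<in> space M" "\<alpha> < \<bar>p x\<bar>"
      then obtain n where "1 / real (Suc n) < \<bar>p x\<bar> - \<alpha>" using nat_approx_posE[of "\<bar>p x\<bar> - \<alpha>"] by auto
      then have "\<alpha> + 1 / real (Suc n) < \<bar>p x\<bar>" by linarith
      with x show "x \<in> (\<Union>n. {x \<in> space M. \<alpha> + 1 / real (Suc n) < \<bar>p x\<bar>})" by blast
    qed
    finally show "m \<alpha> \<le> s" using m_le unfolding m_def by (intro LIMSEQ_le_const2) auto
  qed
  then show ?thesis unfolding rearr m_def by linarith
qed

lemma abs_exponent_levels:
  assumes "p \<in> exponents M"
  shows "{x \<in> space M. \<alpha> < \<bar>p x\<bar>} = {x \<in> space M. \<alpha> < p x}"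
  using exponent_ge1[OF assms] by force

text \<open>On \<open>{m < q \<le> m + 1}\<close> the integrand is at most \<open>K ^ (m + 1)\<close>, so a geometric tail of \<open>q\<close>
  with ratio below \<open>1 / K\<close> makes the sum over the layers converge.\<close>
lemma (in finite_measure) nn_integral_exponential_finite:
  fixes q :: "'a \<Rightarrow> real"
  assumes [measurable]: "q \<in> borel_measurable M" and q: "\<And>x. x \<in> space M \<Longrightarrow> 0 < q x"
    and K: "1 \<le> K" "K * \<theta> < 1" and \<theta>: "0 \<le> \<theta>"
    and decay: "\<And>m. m \<ge> N \<Longrightarrow> measure M {x \<in> space M. real m < q x} \<le> C * \<theta> ^ m"
  shows "(\<integral>\<^sup>+x. ennreal (K powr q x) \<partial>M) < \<infinity>"
proof -
  let ?A = "\<lambda>m::nat. {x \<in> space M. real m < q x}"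
  have member_le: "f m \<le> suminf f" for f :: "nat \<Rightarrow> ennreal" and m
    using sum_le_suminf[of f "{m}"] by simp
  have "(\<integral>\<^sup>+x. ennreal (K powr q x) \<partial>M)
      \<le> (\<integral>\<^sup>+x. (\<Sum>m. ennreal (K ^ Suc m) * indicator (?A m) x) \<partial>M)"
  proof (rule nn_integral_mono)
    fix x assume x: "x \<in> space M"
    define m where "m = nat \<lceil>q x\<rceil> - 1"
    have 1: "0 < \<lceil>q x\<rceil>" using q[OF x] by simp
    have m: "real m < q x" "q x \<le> real (Suc m)" using 1 unfolding m_def by linarith+
    have "K powr q x \<le> K powr real (Suc m)" using m K by (intro powr_mono) auto
    also have "\<dots> = K ^ Suc m" using K by (subst powr_realpow) auto
    finally have "ennreal (K powr q x) \<le> ennreal (K ^ Suc m) * indicator (?A m) x"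
      using m(1) x by (auto intro!: ennreal_leI)
    also have "\<dots> \<le> (\<Sum>m. ennreal (K ^ Suc m) * indicator (?A m) x)"
      by (rule member_le[of "\<lambda>m. ennreal (K ^ Suc m) * indicator (?A m) x"])
    finally show "ennreal (K powr q x) \<le> (\<Sum>m. ennreal (K ^ Suc m) * indicator (?A m) x)" .
  qed
  also have "\<dots> = (\<Sum>m. \<integral>\<^sup>+x. ennreal (K ^ Suc m) * indicator (?A m) x \<partial>M)"
    by (rule nn_integral_suminf) measurable
  also have "\<dots> = (\<Sum>m. ennreal (K ^ Suc m * measure M (?A m)))"
    using K by (simp add: nn_integral_cmult_indicator emeasure_eq_measure ennreal_mult del: power_Suc)
  also have "\<dots> < \<infinity>"
  proof -
    have "summable (\<lambda>m. K ^ Suc m * measure M (?A m))"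
    proof (rule summable_comparison_test)
      have "K ^ Suc m * measure M (?A m) \<le> (K * C) * (K * \<theta>) ^ m" if "m \<ge> N" for m
        using mult_left_mono[OF decay[OF that], of "K ^ Suc m"] K by (simp add: power_mult_distrib algebra_simps)
      then show "\<exists>N. \<forall>m\<ge>N. norm (K ^ Suc m * measure M (?A m)) \<le> (K * C) * (K * \<theta>) ^ m"
        using K by (intro exI[of _ N]) (auto simp: abs_mult)
      show "summable (\<lambda>m. (K * C) * (K * \<theta>) ^ m)"
        using K \<theta> by (intro summable_mult summable_geometric) auto
    qed
    then show ?thesis
      using K by (subst suminf_ennreal2) auto
  qed
  finally show ?thesis .
qed

text \<open>The probability integral transform: \<open>V x\<close> is the rank \<open>F (W x)\<close> of \<open>W x\<close>, where \<open>F\<close> is the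
  distribution function of \<open>W\<close>. Without atoms \<open>F\<close> is continuous and takes every value in \<open>(0, 1)\<close>,
  hence the rank is uniformly distributed on \<open>[0, 1]\<close>. Points where \<open>W\<close> is very small get small
  ranks, and the last conclusion says how small.\<close>
lemma (in prob_space) obtain_uniform_rank:
  fixes W :: "'a \<Rightarrow> real"
  assumes [measurable]: "W \<in> borel_measurable M"
    and atomless: "\<And>w. measure M {x \<in> space M. W x = w} = 0"
  obtains V where "V \<in> borel_measurable M" "\<And>x. 0 < V x"
    "\<And>s. \<lbrakk>0 \<le> s; s \<le> 1\<rbrakk> \<Longrightarrow> measure M {x \<in> space M. V x < s} = s"
    "AE x in M. V x \<le> measure M {y \<in> space M. W y \<le> W x}"
proof -
  define F where "F w = measure M {y \<in> space M. W y \<le> w}" for w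
  interpret D: real_distribution "distr M borel W"
    by (rule real_distribution_distr) measurable
  have F: "F = cdf (distr M borel W)"
    by (auto simp: fun_eq_iff F_def cdf_def measure_distr intro!: arg_cong[of _ _ prob])
  have cont: "isCont F w" for w
  proof -
    have "measure (distr M borel W) {w} = measure M {x \<in> space M. W x = w}"
      by (auto simp: measure_distr intro!: arg_cong[of _ _ prob])
    then show ?thesis unfolding F using atomless by (simp add: D.isCont_cdf)
  qed
  have mono: "F a \<le> F b" if "a \<le> b" for a b
    unfolding F using that by (rule D.cdf_nondecreasing)
  have hit: "\<exists>w. F w = s" if "0 < s" "s < 1" for s
  proof -
    have "\<forall>\<^sub>F w in at_top. s < F w"
      unfolding F using D.cdf_lim_at_top_prob \<open>s < 1\<close> by (rule order_tendstoD)
    then obtain b where b: "\<And>w. b \<le> w \<Longrightarrow> s < F w" by (auto simp: eventually_at_top_linorder)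
    have "\<forall>\<^sub>F w in at_bot. F w < s"
      unfolding F using D.cdf_lim_at_bot \<open>0 < s\<close> by (rule order_tendstoD)
    then obtain a where a: "\<And>w. w \<le> a \<Longrightarrow> F w < s" by (auto simp: eventually_at_bot_linorder)
    have "\<exists>w\<ge>min a b. w \<le> b \<and> F w = s"
      using a[of "min a b"] b[of b] cont by (intro IVT) auto
    then show ?thesis by blast
  qed
  have [measurable]: "F \<in> borel_measurable borel"
    by (intro borel_measurable_mono monoI mono)
  have lower: "r \<le> prob {x \<in> space M. F (W x) < s}" if "0 < r" "r < s" "s \<le> 1" for r s
  proof -
    have "r < 1" using that by linarith
    then obtain w where w: "F w = r" using hit[OF \<open>0 < r\<close>] by blast
    have "r = prob {x \<in> space M. W x \<le> w}" using w by (simp add: F_def)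
    also have "\<dots> \<le> prob {x \<in> space M. F (W x) < s}"
    proof (intro finite_measure_mono subsetI)
      fix x assume "x \<in> {x \<in> space M. W x \<le> w}"
      then show "x \<in> {x \<in> space M. F (W x) < s}" using mono[of "W x" w] w that by auto
    qed measurable
    finally show ?thesis .
  qed
  have upper: "prob {x \<in> space M. F (W x) < s} \<le> s" if s: "0 < s" "s \<le> 1" for s
  proof (cases "s = 1")
    case False
    then obtain w where w: "F w = s" using hit[of s] s by auto
    have "prob {x \<in> space M. F (W x) < s} \<le> prob {x \<in> space M. W x \<le> w}"
    proof (intro finite_measure_mono subsetI)
      fix x assume "x \<in> {x \<in> space M. F (W x) < s}"
      then show "x \<in> {x \<in> space M. W x \<le> w}" using mono[of w "W x"] w by (auto intro: ccontr)
    qed measurable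
    then show ?thesis using w by (simp add: F_def)
  qed simp
  have FW: "prob {x \<in> space M. F (W x) < s} = s" if s: "0 < s" "s \<le> 1" for s
  proof (rule antisym[OF upper[OF s]])
    show "s \<le> prob {x \<in> space M. F (W x) < s}"
      by (rule dense_le_bounded[of 0]) (use s lower in auto)
  qed
  have null: "prob {x \<in> space M. F (W x) = 0} = 0"
  proof -
    have "prob {x \<in> space M. F (W x) = 0} \<le> 0 + e" if "0 < e" for e
    proof -
      have "prob {x \<in> space M. F (W x) = 0} \<le> prob {x \<in> space M. F (W x) < min e 1}"
        using that by (intro finite_measure_mono) auto
      also have "\<dots> \<le> e" using FW[of "min e 1"] that by simp
      finally show ?thesis by simp
    qed
    then have "prob {x \<in> space M. F (W x) = 0} \<le> 0" by (rule field_le_epsilon)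
    then show ?thesis by (simp add: measure_le_0_iff)
  qed
  have "{x \<in> space M. F (W x) = 0} \<in> null_sets M"
    using null by (auto simp: null_sets_def emeasure_eq_measure)
  then have ae: "AE x in M. F (W x) \<noteq> 0"
    by (rule AE_I') auto
  \<comment> \<open>The rank vanishes only on a null set; the value \<open>1\<close> there keeps \<open>V\<close> positive, which matters
    because the rearrangement is meaningful at positive arguments only.\<close>
  define V where "V x = (if F (W x) = 0 then 1 else F (W x))" for x
  have [measurable]: "V \<in> borel_measurable M" unfolding V_def by measurable
  show thesis
  proof
    show "V \<in> borel_measurable M" by measurable
    show "0 < V x" for x unfolding V_def using measure_nonneg[of M] by (auto simp: F_def less_le)
    show "AE x in M. V x \<le> measure M {y \<in> space M. W y \<le> W x}"
      using ae by eventually_elim (simp add: V_def F_def)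
    show "prob {x \<in> space M. V x < s} = s" if s: "0 \<le> s" "s \<le> 1" for s
    proof (cases "s = 0")
      case True
      have "0 \<le> V x" for x unfolding V_def using measure_nonneg[of M] by (auto simp: F_def)
      then have empty: "{x \<in> space M. V x < s} = {}" using True by (auto simp: not_less)
      show ?thesis unfolding empty using True by simp
    next
      case False
      have "prob {x \<in> space M. V x < s} = prob {x \<in> space M. F (W x) < s}"
      proof (rule finite_measure_eq_AE)
        show "AE x in M. x \<in> {x \<in> space M. V x < s} \<longleftrightarrow> x \<in> {x \<in> space M. F (W x) < s}"
          using ae by eventually_elim (simp add: V_def)
      qed measurable
      then show ?thesis using FW False s by simp
    qed
  qed
qed

section \<open>The unit cube as a probability space\<close>
lemma prob_space_unit_cube: "prob_space (lebesgue_on (unit_cube :: (real ^ 'n) set))"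
proof (rule prob_spaceI)
  have "measure lebesgue (cbox 0 1 :: (real ^ 'n) set) = 1"
    by (simp add: content_cbox_if_cart interval_ne_empty_cart)
  then have "emeasure lebesgue (cbox 0 1 :: (real ^ 'n) set) = 1"
    by (simp add: emeasure_eq_measure2 lmeasurable_cbox)
  then show "emeasure (lebesgue_on unit_cube) (space (lebesgue_on (unit_cube :: (real ^ 'n) set))) = 1"
    by (simp add: unit_cube_eq_cbox emeasure_restrict_space)
qed

lemma sets_unit_cube [measurable]: "unit_cube \<in> sets lebesgue"
  by (simp add: unit_cube_eq_cbox)

lemma sets_lebesgue_on_unit_cube:
  "A \<in> sets (lebesgue_on unit_cube) \<longleftrightarrow> A \<in> sets lebesgue \<and> A \<subseteq> unit_cube"
  using sets_restrict_space_iff[of unit_cube lebesgue A] by (auto simp: unit_cube_eq_cbox)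

lemma measure_lebesgue_on_unit_cube:
  "A \<subseteq> unit_cube \<Longrightarrow> measure (lebesgue_on unit_cube) A = measure lebesgue A"
  by (rule measure_restrict_space) (auto simp: unit_cube_eq_cbox)

lemma measure_small_cube:
  fixes d :: "real ^ 'n"
  assumes "0 \<le> s"
  shows "measure lebesgue (cbox d (\<chi> i. d $ i + s)) = s ^ CARD('n)"
proof -
  have "cbox d (\<chi> i. d $ i + s) \<noteq> {}" using assms by (simp add: interval_ne_empty_cart)
  then show ?thesis by (simp add: content_cbox_if_cart)
qed

lemma measure_countably_many_coordinate_levels:
  fixes A :: "(real ^ 'n) set"
  assumes "countable C" "A \<subseteq> unit_cube" "\<And>x. x \<in> A \<Longrightarrow> x $ i \<in> C"
  shows "measure (lebesgue_on unit_cube) A = 0"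
proof -
  have "negligible {x::real^'n. x $ i = c}" for c
    using negligible_standard_hyperplane[of "axis i (1::real)" c] by (simp add: cart_eq_inner_axis Basis_real_def)
  then have "negligible (\<Union>c\<in>C. {x::real^'n. x $ i = c})"
    using assms(1) by (intro negligible_countable_Union) auto
  then have "negligible A" by (rule negligible_subset) (use assms(3) in auto)
  then show ?thesis using assms(2) by (simp add: measure_lebesgue_on_unit_cube negligible_imp_measure0)
qed

section \<open>A uniform variable with small values in every open set\<close>
text \<open>The difficulty is to give every nonempty open subset of the cube at least a quarter
  of the mass \<open>t j\<close> of some \<open>{V < t j}\<close>. At the points of a dense sequence put cubes \<open>Q j\<close> of
  measure \<open>t j / 4\<close>. As the \<open>t j\<close> decay geometrically, \<open>Q j, Q (j + 1), \<dots>\<close> together have measure at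
  most \<open>t j / 2\<close>. So it suffices that \<open>V\<close> gives lower ranks to points that lie in later cubes: the
  rank of a point of \<open>Q j\<close> is then at most \<open>t j / 2\<close>.\<close>
lemma obtain_concentrated_uniform:
  fixes t :: "nat \<Rightarrow> real"
  defines "M \<equiv> lebesgue_on (unit_cube :: (real ^ 'n) set)"
  assumes pos: "\<And>j. 0 < t j" and half: "\<And>j. t (Suc j) \<le> t j / 2"
  obtains V :: "real ^ 'n \<Rightarrow> real" where "V \<in> borel_measurable M" "\<And>x. 0 < V x"
    "\<And>s. \<lbrakk>0 \<le> s; s \<le> 1\<rbrakk> \<Longrightarrow> measure M {x \<in> space M. V x < s} = s"
    "\<And>U. \<lbrakk>open U; U \<noteq> {}; U \<subseteq> unit_cube\<rbrakk> \<Longrightarrow> \<exists>j. t j / 4 \<le> measure M {x \<in> U. V x < t j}"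
proof -
  interpret prob_space M unfolding M_def by (rule prob_space_unit_cube)
  have space: "space M = unit_cube" by (simp add: M_def)
  have decay: "t (j + k) \<le> t j * (1/2) ^ k" for j k
  proof (induction k)
    case (Suc k)
    then show ?case using half[of "j + k"] by simp
  qed simp
  have "t \<longlonglongrightarrow> 0"
  proof (rule tendsto_sandwich[where f = "\<lambda>_. 0" and h = "\<lambda>j. t 0 * (1/2) ^ j"])
    show "(\<lambda>j. t 0 * (1/2) ^ j) \<longlonglongrightarrow> 0" by (intro tendsto_mult_right_zero LIMSEQ_power_zero) auto
    show "\<forall>\<^sub>F j in sequentially. t j \<le> t 0 * (1/2) ^ j" using decay[of 0] by simp
    show "\<forall>\<^sub>F j in sequentially. 0 \<le> t j" using pos by (simp add: less_imp_le)
  qed simp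
  define s where "s j = root CARD('n) (t j / 4)" for j
  have s_pos: "0 < s j" for j using pos by (simp add: s_def)
  have s_pow: "s j ^ CARD('n) = t j / 4" for j
    unfolding s_def using pos by (intro real_root_pow_pos2) (auto simp: less_imp_le)
  have "(\<lambda>j. t j / 4) \<longlonglongrightarrow> 0 / 4" by (intro tendsto_intros \<open>t \<longlonglongrightarrow> 0\<close>) simp
  then have s_0: "s \<longlonglongrightarrow> 0"
    unfolding s_def using tendsto_real_root[of "\<lambda>j. t j / 4" 0 sequentially "CARD('n)"] by simp

  obtain D :: "(real ^ 'n) set" where D: "countable D" "\<And>U. \<lbrakk>open U; U \<noteq> {}\<rbrakk> \<Longrightarrow> \<exists>d\<in>D. d \<in> U"
    using countable_dense_exists by metis
  \<comment> \<open>Decoding pairs repeats each dense point infinitely often, so that open sets are visited at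
    arbitrarily late stages, when the cubes are already small.\<close>
  define d where "d j = from_nat_into D (fst (prod_decode j))" for j
  have d_dense: "\<exists>j\<ge>m. d j \<in> U" if U: "open U" "U \<noteq> {}" for U m
  proof -
    obtain x where x: "x \<in> D" "x \<in> U" using D(2)[OF U] by blast
    have "d (prod_encode (to_nat_on D x, m)) = x"
      using x D(1) by (simp add: d_def)
    then show ?thesis using x le_prod_encode_2[of m "to_nat_on D x"] by metis
  qed
  define Q where "Q j = cbox (d j) (\<chi> i. d j $ i + s j)" for j
  have measure_Q: "measure lebesgue (Q j) = t j / 4" for j
    unfolding Q_def using s_pos[of j] s_pow measure_small_cube[of "s j" "d j"] by simp
  define E where "E j = Q j \<inter> unit_cube" for j
  have E_sets [measurable]: "E j \<in> sets M" for j
    by (auto simp: E_def M_def Q_def sets_lebesgue_on_unit_cube intro!: sets.Int sets_unit_cube)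
  have measure_E: "measure M (E j) \<le> t j / 4" for j
  proof -
    have "measure M (E j) = measure lebesgue (E j)" by (simp add: M_def E_def measure_lebesgue_on_unit_cube)
    also have "\<dots> \<le> measure lebesgue (Q j)"
      unfolding E_def Q_def unit_cube_eq_cbox
      by (intro measure_mono_fmeasurable) (auto simp: lmeasurable_cbox)
    finally show ?thesis by (simp add: measure_Q)
  qed
  have tail: "summable (\<lambda>i. measure M (E (j + i)))" "measure M (\<Union>i. E (j + i)) \<le> t j / 2" for j
  proof -
    have le: "measure M (E (j + i)) \<le> t j / 4 * (1/2) ^ i" for i
      using measure_E[of "j + i"] decay[of j i] by simp
    have geo: "(\<lambda>i. t j / 4 * (1/2) ^ i) sums (t j / 4 * (1 / (1 - 1/2)))"
      by (intro sums_mult geometric_sums) simp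
    show *: "summable (\<lambda>i. measure M (E (j + i)))"
      using le by (intro summable_comparison_test[OF _ sums_summable[OF geo]]) auto
    have "measure M (\<Union>i. E (j + i)) \<le> (\<Sum>i. measure M (E (j + i)))"
      using * by (intro finite_measure_subadditive_countably) auto
    also have "\<dots> \<le> (\<Sum>i. t j / 4 * (1/2) ^ i)"
      using le * sums_summable[OF geo] by (intro suminf_le) auto
    also have "\<dots> = t j / 2" using sums_unique[OF geo] by simp
    finally show "measure M (\<Union>i. E (j + i)) \<le> t j / 2" .
  qed

  \<comment> \<open>One more than the index of the last cube that contains the point, or \<open>0\<close> if there is none (almost everywhere).\<close>
  define N where "N x = (LEAST n. \<forall>j\<ge>n. x \<notin> E j)" for x
  have [measurable]: "N \<in> measurable M (count_space UNIV)"
    unfolding N_def by measurable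
  have N_upper: "\<exists>j\<ge>n. x \<in> E j" if "n < N x" for n x
    using that not_less_Least unfolding N_def by blast
  have "AE x in M. \<forall>\<^sub>F j in sequentially. x \<in> space M - E j"
    using tail(1)[of 0] by (intro borel_cantelli_AE1) (auto simp: emeasure_eq_measure)
  then have N_lower: "AE x in M. \<forall>j. x \<in> E j \<longrightarrow> j < N x"
  proof eventually_elim
    case (elim x)
    then obtain n where "\<forall>j\<ge>n. x \<notin> E j" by (auto simp: eventually_sequentially)
    then have "\<forall>j\<ge>N x. x \<notin> E j" unfolding N_def by (rule LeastI)
    then show ?case by (meson not_less)
  qed

  fix i :: 'n
  \<comment> \<open>The coordinate makes the distribution of \<open>W\<close> atomless. The factor \<open>2\<close> exceeds the range of the
    coordinate by enough that \<open>W y \<le> W x\<close> with \<open>j < N x\<close> forces \<open>j < N y\<close>.\<close>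
  define W where "W x = x $ i - 2 * real (N x)" for x
  have [measurable]: "(\<lambda>x. x $ i) \<in> borel_measurable M"
    unfolding M_def by (intro continuous_imp_measurable_on_sets_lebesgue continuous_intros sets_unit_cube)
  have W [measurable]: "W \<in> borel_measurable M" unfolding W_def by measurable
  have atomless: "measure M {x \<in> space M. W x = w} = 0" for w
    unfolding M_def
    by (rule measure_countably_many_coordinate_levels[of "range (\<lambda>n. w + 2 * real n)" _ i]) (auto simp: W_def)
  obtain V where V: "V \<in> borel_measurable M" "\<And>x. 0 < V x"
      "\<And>s. \<lbrakk>0 \<le> s; s \<le> 1\<rbrakk> \<Longrightarrow> measure M {x \<in> space M. V x < s} = s"
      "AE x in M. V x \<le> measure M {y \<in> space M. W y \<le> W x}"
    using obtain_uniform_rank[OF W atomless] by blast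
  have small: "AE x in M. \<forall>j. x \<in> E j \<longrightarrow> V x < t j"
    using V(4) N_lower
  proof eventually_elim
    case (elim x)
    show ?case
    proof (intro allI impI)
      fix j assume xj: "x \<in> E j"
      then have "Suc j \<le> N x" and "x $ i \<le> 1" using elim by (auto simp: E_def unit_cube_def)
      then have "real (Suc j) \<le> real (N x)" by (simp only: of_nat_le_iff)
      then have Wx: "W x \<le> - (2 * real j) - 1" using \<open>x $ i \<le> 1\<close> by (simp add: W_def)
      have "{y \<in> space M. W y \<le> W x} \<subseteq> (\<Union>i. E (j + i))"
      proof safe
        fix y assume y: "y \<in> space M" "W y \<le> W x"
        have "0 \<le> y $ i" using y(1) by (simp add: space unit_cube_def)
        then have "real j < real (N y)" using y(2) Wx by (simp add: W_def)
        then obtain k where "k \<ge> j" "y \<in> E k" using N_upper[of j y] by auto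
        then show "y \<in> (\<Union>i. E (j + i))" by (auto intro!: exI[of _ "k - j"])
      qed
      then have "measure M {y \<in> space M. W y \<le> W x} \<le> measure M (\<Union>i. E (j + i))"
        by (intro finite_measure_mono) auto
      then show "V x < t j" using tail(2)[of j] elim(1) pos[of j] by linarith
    qed
  qed
  show thesis
  proof (rule that[OF V(1-3)])
    fix U :: "(real ^ 'n) set" assume U: "open U" "U \<noteq> {}" "U \<subseteq> unit_cube"
    then obtain u e where e: "0 < e" "ball u e \<subseteq> U" by (meson ex_in_conv open_contains_ball)
    have "\<forall>\<^sub>F j in sequentially. s j < e / (2 * real CARD('n))"
      using s_0 e by (intro order_tendstoD(2)[OF s_0]) auto
    then obtain m where m: "\<And>j. j \<ge> m \<Longrightarrow> s j < e / (2 * real CARD('n))"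
      by (auto simp: eventually_sequentially)
    obtain j where j: "j \<ge> m" "d j \<in> ball u (e / 2)" using d_dense[of "ball u (e/2)" m] e by auto
    have Q_sub: "Q j \<subseteq> U"
    proof
      fix y assume y: "y \<in> Q j"
      have "\<bar>(y - d j) $ i\<bar> \<le> s j" for i using y by (auto simp: Q_def mem_box_cart dest: spec[of _ i])
      then have "norm (y - d j) \<le> (\<Sum>i\<in>(UNIV::'n set). s j)"
        by (intro order_trans[OF norm_le_l1_cart] sum_mono)
      also have "\<dots> < e / 2" using m[OF j(1)] by (simp add: field_simps)
      finally have "dist (d j) y < e / 2" by (simp add: dist_norm norm_minus_commute)
      then have "dist u y < e" using j(2) dist_triangle[of u y "d j"] by simp
      then show "y \<in> U" using e by auto
    qed
    have [measurable]: "U \<in> sets M" using U by (auto simp: M_def sets_lebesgue_on_unit_cube)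
    have set: "{x \<in> U. V x < t j} = U \<inter> {x \<in> space M. V x < t j}" using U by (auto simp: space)
    have "t j / 4 = measure M (E j)"
      using Q_sub U measure_Q[of j] by (simp add: E_def M_def measure_lebesgue_on_unit_cube Int_absorb2)
    also have "\<dots> \<le> measure M {x \<in> U. V x < t j}"
    proof (rule finite_measure_mono_AE)
      show "AE x in M. x \<in> E j \<longrightarrow> x \<in> {x \<in> U. V x < t j}"
        using small by eventually_elim (use Q_sub in \<open>auto simp: E_def\<close>)
      show "{x \<in> U. V x < t j} \<in> sets M" unfolding set using V(1) by measurable
    qed
    finally show "\<exists>j. t j / 4 \<le> measure M {x \<in> U. V x < t j}" by blast
  qed
qed

section \<open>An exponent that is large in every open set\<close>
text \<open>The inequality \<open>c ln (e / t) < p\<^sup>* t\<close> holds for arbitrarily small \<open>t\<close>, which allows the \<open>t j\<close> to be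
  picked one after the other, each at most half of the previous one.\<close>
lemma (in prob_space) obtain_fast_levels:
  assumes p: "p \<in> exponents M"
    and lim: "0 < Limsup (at_right 0) (\<lambda>t. ereal (decreasing_rearrangement M p t / ln (exp 1 / t)))"
  obtains c :: real and t :: "nat \<Rightarrow> real" where "0 < c" "\<And>j. 0 < t j" "\<And>j. t j < 1"
    "\<And>j. t (Suc j) \<le> t j / 2"
    "\<And>j. t j < measure M {x \<in> space M. c * ln (exp 1 / t j) < p x}"
proof -
  have [measurable]: "p \<in> borel_measurable M" by (rule exponent_measurable[OF p])
  obtain c where c: "0 < c" "ereal c < Limsup (at_right 0) (\<lambda>t. ereal (decreasing_rearrangement M p t / ln (exp 1 / t)))"
    using ereal_dense2[OF lim] by auto
  have ex: "\<exists>t. 0 < t \<and> t < b \<and> t < measure M {x \<in> space M. c * ln (exp 1 / t) < p x}"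
    if b: "0 < b" "b \<le> 1" for b
  proof (rule ccontr)
    assume neg: "\<not> ?thesis"
    have "\<forall>\<^sub>F t in at_right 0. ereal (decreasing_rearrangement M p t / ln (exp 1 / t)) \<le> ereal c"
      unfolding eventually_at_right_field
    proof (intro exI[of _ b] conjI allI impI b)
      fix t :: real assume t: "0 < t" "t < b"
      have "ln t < 1" using ln_less_zero[of t] t b by linarith
      then have ln: "0 < ln (exp 1 / t)" using t by (simp add: ln_div)
      have "decreasing_rearrangement M p t \<le> c * ln (exp 1 / t)"
        using abs_exponent_levels[OF p, of "c * ln (exp 1 / t)"]
          less_decreasing_rearrangement_iff[of p t "c * ln (exp 1 / t)"] neg t c(1) ln by auto
      then show "ereal (decreasing_rearrangement M p t / ln (exp 1 / t)) \<le> ereal c"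
        using ln by (simp add: pos_divide_le_eq)
    qed
    from Limsup_bounded[OF this] c(2) show False by simp
  qed
  define good where "good t \<longleftrightarrow> 0 < t \<and> t < 1 \<and> t < measure M {x \<in> space M. c * ln (exp 1 / t) < p x}" for t
  have "\<exists>t. \<forall>n. good (t n) \<and> t (Suc n) \<le> t n / 2"
  proof (rule dependent_nat_choice)
    show "\<exists>x. good x" using ex[of 1] by (auto simp: good_def)
    show "\<exists>y. good y \<and> y \<le> x / 2" if "good x" for x n
      using ex[of "x / 2"] that by (fastforce simp: good_def)
  qed
  then obtain t where "\<And>n. good (t n)" and "\<And>n. t (Suc n) \<le> t n / 2" by blast
  then show thesis unfolding good_def by (intro that[OF c(1), of t]) auto
qed

text \<open>The exponent is \<open>p\<^sup>* \<circ> V\<close>, which has the distribution of \<open>p\<close> because \<open>V\<close> is uniform. Where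
  \<open>V < t j\<close> it exceeds \<open>c ln (e / t j)\<close>, so with \<open>K = exp (2 / c)\<close> the integrand is at least
  \<open>(e / t j)\<^sup>2\<close>; this outweighs the measure \<open>t j / 4\<close> that \<open>{V < t j}\<close> has in the open set.\<close>
lemma obtain_concentrated_exponent:
  fixes p :: "real ^ 'n \<Rightarrow> real"
  defines "M \<equiv> lebesgue_on (unit_cube :: (real ^ 'n) set)"
  assumes p: "p \<in> exponents M"
    and lim: "0 < Limsup (at_right 0) (\<lambda>t. ereal (decreasing_rearrangement M p t / ln (exp 1 / t)))"
  obtains q K where "q \<in> equimeasurable_class M p" "0 < K"
    "\<And>U. \<lbrakk>open U; U \<noteq> {}; U \<subseteq> unit_cube\<rbrakk> \<Longrightarrow> 1 < (\<integral>\<^sup>+x\<in>U. ennreal (K powr q x) \<partial>M)"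
proof -
  interpret prob_space M unfolding M_def by (rule prob_space_unit_cube)
  have space: "space M = unit_cube" by (simp add: M_def)
  have [measurable]: "p \<in> borel_measurable M" by (rule exponent_measurable[OF p])
  define m where "m \<alpha> = measure M {x \<in> space M. \<alpha> < p x}" for \<alpha>
  obtain c and t :: "nat \<Rightarrow> real" where c: "0 < c" and t: "\<And>j. 0 < t j" "\<And>j. t j < 1" "\<And>j. t (Suc j) \<le> t j / 2"
      "\<And>j. t j < m (c * ln (exp 1 / t j))"
    by (rule obtain_fast_levels[OF p lim, folded m_def]) (rule that, assumption+)
  obtain V where V [measurable]: "V \<in> borel_measurable M" and V_pos: "\<And>x. 0 < V x"
    and uniform: "\<And>s. \<lbrakk>0 \<le> s; s \<le> 1\<rbrakk> \<Longrightarrow> measure M {x \<in> space M. V x < s} = s"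
    and conc: "\<And>U. \<lbrakk>open U; U \<noteq> {}; U \<subseteq> unit_cube\<rbrakk> \<Longrightarrow> \<exists>j. t j / 4 \<le> measure M {x \<in> U. V x < t j}"
    by (rule obtain_concentrated_uniform[of t, where 'n = 'n, folded M_def, OF t(1,3)]) (rule that, assumption+)
  \<comment> \<open>The maximum repairs only the null set \<open>{V \<ge> 1}\<close>, where the rearrangement may drop below \<open>1\<close>.\<close>
  define q where "q x = max 1 (decreasing_rearrangement M p (V x))" for x
  have key: "\<alpha> < decreasing_rearrangement M p (V x) \<longleftrightarrow> V x < m \<alpha>" if "0 \<le> \<alpha>" for \<alpha> x
    using less_decreasing_rearrangement_iff[of p "V x" \<alpha>] V_pos[of x] that abs_exponent_levels[OF p]
    by (simp add: m_def)
  have level: "{x \<in> space M. \<alpha> < q x} = (if \<alpha> < 1 then space M else {x \<in> space M. V x < m \<alpha>})" for \<alpha>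
    using key[of \<alpha>] by (auto simp: q_def less_max_iff_disj)
  have q_meas [measurable]: "q \<in> borel_measurable M"
    unfolding borel_measurable_iff_greater level by auto
  have q: "q \<in> equimeasurable_class M p"
    unfolding equimeasurable_class_def equimeasurable_def
  proof (intro CollectI conjI allI impI)
    show "q \<in> exponents M" by (auto simp: exponents_def q_def[abs_def] intro: q_meas[unfolded q_def[abs_def]])
    fix \<alpha> :: real assume \<alpha>: "0 \<le> \<alpha>"
    show "emeasure M {x \<in> space M. \<alpha> < p x} = emeasure M {x \<in> space M. \<alpha> < q x}"
    proof (cases "\<alpha> < 1")
      case True
      then have "{x \<in> space M. \<alpha> < p x} = space M" using exponent_ge1[OF p] by force
      then show ?thesis using True by (simp add: level)
    next
      case False
      then have "measure M {x \<in> space M. \<alpha> < q x} = m \<alpha>"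
        using uniform[of "m \<alpha>"] by (simp add: level m_def)
      then show ?thesis by (simp add: emeasure_eq_measure m_def)
    qed
  qed
  define K where "K = exp (2 / c)"
  have K: "1 \<le> K" using c by (simp add: K_def)
  show thesis
  proof (rule that[OF q])
    show "0 < K" by (simp add: K_def)
    fix U :: "(real ^ 'n) set" assume U: "open U" "U \<noteq> {}" "U \<subseteq> unit_cube"
    obtain j where j: "t j / 4 \<le> measure M {x \<in> U. V x < t j}" using conc[OF U] by blast
    define S where "S = {x \<in> U. V x < t j}"
    have [measurable]: "U \<in> sets M" using U by (auto simp: M_def sets_lebesgue_on_unit_cube)
    have "S = U \<inter> {x \<in> space M. V x < t j}" using U by (auto simp: space S_def)
    then have [measurable]: "S \<in> sets M" by simp
    have "ln (t j) < 1" using ln_less_zero[of "t j"] t(1,2)[of j] by linarith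
    then have ln: "0 < ln (exp 1 / t j)" using t(1)[of j] by (simp add: ln_div)
    have big: "(exp 1 / t j)\<^sup>2 \<le> K powr q x" if "x \<in> S" for x
    proof -
      have "V x < m (c * ln (exp 1 / t j))" using that t(4)[of j] by (simp add: S_def)
      then have "c * ln (exp 1 / t j) < decreasing_rearrangement M p (V x)" using key c ln by simp
      then have "c * ln (exp 1 / t j) \<le> q x" by (simp add: q_def)
      then have "K powr (c * ln (exp 1 / t j)) \<le> K powr q x" using K by (intro powr_mono) auto
      moreover have "K powr (c * ln (exp 1 / t j)) = exp (2 * ln (exp 1 / t j))"
        using c by (simp add: K_def powr_def)
      moreover have "exp (2 * ln (exp 1 / t j)) = (exp 1 / t j)\<^sup>2"
        using t(1)[of j] by (simp only: exp_double) (simp add: exp_ln)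
      ultimately show ?thesis by simp
    qed
    have "1 < 1 / t j" using t(1,2)[of j] by simp
    also have "\<dots> = (2 / t j)\<^sup>2 * (t j / 4)" using t(1)[of j] by (simp add: power2_eq_square)
    also have "\<dots> \<le> (exp 1 / t j)\<^sup>2 * measure M S"
      using j t(1)[of j] exp_ge_add_one_self[of 1] unfolding S_def
      by (intro mult_mono power_mono divide_right_mono) auto
    finally have "1 < ennreal ((exp 1 / t j)\<^sup>2 * measure M S)" by (simp add: one_less_ennreal)
    also have "\<dots> = (\<integral>\<^sup>+x. ennreal ((exp 1 / t j)\<^sup>2) * indicator S x \<partial>M)"
      by (simp add: nn_integral_cmult_indicator emeasure_eq_measure ennreal_mult)
    also have "\<dots> \<le> (\<integral>\<^sup>+x\<in>U. ennreal (K powr q x) \<partial>M)"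
      using big by (intro nn_integral_mono) (auto simp: indicator_def S_def intro!: ennreal_leI)
    finally show "1 < (\<integral>\<^sup>+x\<in>U. ennreal (K powr q x) \<partial>M)" .
  qed
qed

section \<open>Continuous functions in the variable exponent space\<close>
lemma AE_unit_cube_open_witness:
  fixes U :: "(real ^ 'n) set"
  assumes ae: "AE x in lebesgue_on unit_cube. P x" and U: "open U" "U \<noteq> {}" "U \<subseteq> unit_cube"
  obtains x where "x \<in> U" "P x"
proof (rule ccontr)
  assume "\<not> thesis"
  with that have none: "\<And>x. x \<in> U \<Longrightarrow> \<not> P x" by blast
  have "AE x in lebesgue. x \<in> unit_cube \<longrightarrow> P x"
    using ae AE_restrict_space_iff[of unit_cube lebesgue P] by (simp add: sets_unit_cube)
  then have "AE x in lebesgue. x \<notin> U"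
    by eventually_elim (use none U in auto)
  then have "negligible U"
    using U(1) by (simp add: negligible_iff_null_sets AE_iff_null_sets)
  then show False using open_not_negligible U by blast
qed

lemma continuous_on_measurable_unit_cube:
  "continuous_on unit_cube f \<Longrightarrow> f \<in> borel_measurable (lebesgue_on unit_cube)"
  by (intro continuous_imp_measurable_on_sets_lebesgue sets_unit_cube)

lemma (in prob_space) var_modular_le_1:
  assumes q: "q \<in> exponents M" and f: "\<And>x. x \<in> space M \<Longrightarrow> \<bar>f x\<bar> \<le> b" and b: "0 < b"
  shows "var_modular M q (\<lambda>x. f x / b) \<le> 1"
proof -
  have "var_modular M q (\<lambda>x. f x / b) \<le> (\<integral>\<^sup>+x. 1 \<partial>M)"
    unfolding var_modular_def
  proof (rule nn_integral_mono)
    fix x assume x: "x \<in> space M"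
    have "\<bar>f x / b\<bar> powr q x \<le> 1"
      using f[OF x] b exponent_ge1[OF q x] by (intro powr_le1) (auto simp: abs_divide)
    then show "ennreal (\<bar>f x / b\<bar> powr q x) \<le> 1" by simp
  qed
  then show ?thesis by (simp add: emeasure_space_1)
qed

lemma (in prob_space) bounded_in_var_Lfun:
  assumes q: "q \<in> exponents M" and f: "f \<in> borel_measurable M" "\<And>x. x \<in> space M \<Longrightarrow> \<bar>f x\<bar> \<le> b"
  shows "f \<in> var_Lfun M q"
proof -
  define c where "c = max b 1"
  have "var_modular M q (\<lambda>x. f x / c) \<le> 1"
    using f by (intro var_modular_le_1[OF q]) (force simp: c_def)+
  then have "var_modular M q (\<lambda>x. f x / c) < \<infinity>" by (rule le_less_trans) simp
  moreover have "0 < c" by (simp add: c_def)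
  ultimately show ?thesis using f(1) by (auto simp: var_Lfun_def)
qed

lemma continuous_on_in_var_Lfun:
  fixes f :: "real ^ 'n \<Rightarrow> real"
  assumes q: "q \<in> exponents (lebesgue_on unit_cube)" and f: "continuous_on unit_cube f"
  shows "f \<in> var_Lfun (lebesgue_on unit_cube) q"
proof -
  interpret prob_space "lebesgue_on (unit_cube :: (real ^ 'n) set)" by (rule prob_space_unit_cube)
  have "compact (f ` unit_cube)"
    using f by (intro compact_continuous_image) (auto simp: unit_cube_eq_cbox)
  then obtain b where "\<forall>y\<in>f ` unit_cube. norm y \<le> b"
    using compact_imp_bounded bounded_iff by blast
  then show ?thesis
    using bounded_in_var_Lfun[OF q continuous_on_measurable_unit_cube[OF f], of b] by auto
qed

text \<open>A norm that dominates the supremum norm on continuous functions turns a sequence of them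
  converging in the space into a uniformly Cauchy one. Its uniform limit is continuous, and it is
  also the limit in the space, since on a probability space the Luxemburg norm is at most the
  supremum norm.\<close>
lemma closed_subspace_var_L_if_dominates_sup:
  fixes q :: "real ^ 'n \<Rightarrow> real"
  defines "M \<equiv> lebesgue_on (unit_cube :: (real ^ 'n) set)"
  assumes q: "q \<in> exponents M" and K: "0 < K"
    and dom: "\<And>f x. \<lbrakk>continuous_on unit_cube f; x \<in> unit_cube\<rbrakk> \<Longrightarrow> \<bar>f x\<bar> \<le> K * luxemburg M q f"
  shows "closed_subspace_var_L M q (continuous_classes unit_cube)"
proof -
  interpret prob_space M unfolding M_def by (rule prob_space_unit_cube)
  have space: "space M = unit_cube" by (simp add: M_def)
  interpret L: Metric_space "var_L M q" "var_L_dist M q" by (rule Metric_space_var_L[OF q])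
  let ?C = "continuous_classes (unit_cube :: (real ^ 'n) set)"
  have C: "?C = ae_class M ` {f. continuous_on unit_cube f}" by (simp add: continuous_classes_def M_def)
  have meas: "f \<in> borel_measurable M" and mem: "f \<in> var_Lfun M q" if "continuous_on unit_cube f" for f
    using that continuous_on_measurable_unit_cube continuous_on_in_var_Lfun q unfolding M_def by blast+
  have sub: "?C \<subseteq> var_L M q" using mem by (auto simp: C var_L_def)
  have "closedin L.mtopology ?C"
    unfolding L.metric_closedin_iff_sequentially_closed
  proof (intro conjI allI impI sub)
    fix \<sigma> l assume "range \<sigma> \<subseteq> ?C \<and> limitin L.mtopology \<sigma> l sequentially"
    then have \<sigma>: "range \<sigma> \<subseteq> ?C" and lim: "limitin L.mtopology \<sigma> l sequentially" by auto
    have "\<forall>n. \<exists>f. continuous_on unit_cube f \<and> \<sigma> n = ae_class M f" using \<sigma> by (auto simp: C)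
    then obtain f where f: "\<And>n. continuous_on unit_cube (f n)" "\<And>n. \<sigma> n = ae_class M (f n)" by metis
    obtain g where g: "g \<in> var_Lfun M q" "l = ae_class M g"
      using L.limitin_mspace[OF lim] by (auto simp: var_L_def)
    have conv: "\<forall>\<^sub>F n in sequentially. luxemburg M q (\<lambda>x. f n x - g x) < e" if "0 < e" for e
      using lim that unfolding L.limitin_metric
      by (auto simp: f(2) g(2) var_L_dist_ae_class[OF mem[OF f(1)] g(1)] elim: eventually_mono dest!: spec[of _ e])
    have minus: "luxemburg M q (\<lambda>x. a x - b x) = luxemburg M q (\<lambda>x. b x - a x)" for a b
      using luxemburg_uminus[OF q, of "\<lambda>x. b x - a x"] by simp
    have tri: "luxemburg M q (\<lambda>x. a x - c x) \<le> luxemburg M q (\<lambda>x. a x - b x) + luxemburg M q (\<lambda>x. b x - c x)"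
      if "a \<in> var_Lfun M q" "b \<in> var_Lfun M q" "c \<in> var_Lfun M q" for a b c
      using luxemburg_triangle[OF q var_Lfun_diff[OF q that(1,2)] var_Lfun_diff[OF q that(2,3)]] by simp
    have "uniformly_Cauchy_on unit_cube f"
    proof (rule uniformly_Cauchy_onI)
      fix e :: real assume e: "0 < e"
      then obtain m where m: "\<And>n. n \<ge> m \<Longrightarrow> luxemburg M q (\<lambda>x. f n x - g x) < e / (2 * K)"
        using conv[of "e / (2 * K)"] K by (auto simp: eventually_sequentially)
      have "dist (f a x) (f b x) < e" if "x \<in> unit_cube" "a \<ge> m" "b \<ge> m" for x a b
      proof -
        have "dist (f a x) (f b x) \<le> K * luxemburg M q (\<lambda>x. f a x - f b x)"
          using dom[of "\<lambda>x. f a x - f b x" x] f(1) that by (simp add: dist_real_def continuous_on_diff)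
        also have "\<dots> \<le> K * (luxemburg M q (\<lambda>x. f a x - g x) + luxemburg M q (\<lambda>x. f b x - g x))"
          using K tri[OF mem[OF f(1)] g(1) mem[OF f(1)], of a b] minus[of g "f b"] by simp
        also have "\<dots> < K * (e / (2 * K) + e / (2 * K))"
          using m that K by (intro mult_strict_left_mono add_strict_mono) auto
        also have "\<dots> = e" using K by (simp add: field_simps)
        finally show ?thesis .
      qed
      then show "\<exists>m. \<forall>x\<in>unit_cube. \<forall>a\<ge>m. \<forall>b\<ge>m. dist (f a x) (f b x) < e" by blast
    qed
    then have "uniformly_convergent_on unit_cube f" by (rule Cauchy_uniformly_convergent)
    then obtain h where h: "uniform_limit unit_cube f h sequentially"
      by (auto simp: uniformly_convergent_on_def)
    have cont_h: "continuous_on unit_cube h"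
      by (rule uniform_limit_theorem[OF _ h]) (use f(1) in auto)
    have "luxemburg M q (\<lambda>x. g x - h x) \<le> 0 + e" if e: "0 < e" for e
    proof -
      have "\<forall>\<^sub>F n in sequentially. \<forall>x\<in>unit_cube. dist (f n x) (h x) < e / 2"
        using uniform_limitD[OF h, of "e / 2"] e by simp
      moreover have "\<forall>\<^sub>F n in sequentially. luxemburg M q (\<lambda>x. f n x - g x) < e / 2"
        using conv[of "e / 2"] e by simp
      ultimately have "\<forall>\<^sub>F n in sequentially. (\<forall>x\<in>unit_cube. dist (f n x) (h x) < e / 2) \<and>
          luxemburg M q (\<lambda>x. f n x - g x) < e / 2"
        by (rule eventually_conj)
      then obtain n where n: "\<And>x. x \<in> unit_cube \<Longrightarrow> dist (f n x) (h x) < e / 2"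
          "luxemburg M q (\<lambda>x. f n x - g x) < e / 2"
        by (auto simp: eventually_sequentially)
      have "luxemburg M q (\<lambda>x. f n x - h x) \<le> e / 2"
        using n(1) e by (intro luxemburg_le[OF q] var_modular_le_1[OF q])
          (auto simp: space dist_real_def less_imp_le)
      then show ?thesis
        using tri[OF g(1) mem[OF f(1)] mem[OF cont_h], of n] n(2) minus[of g "f n"] by simp
    qed
    then have "luxemburg M q (\<lambda>x. g x - h x) \<le> 0" by (rule field_le_epsilon)
    then have "luxemburg M q (\<lambda>x. g x - h x) = 0"
      using luxemburg_nonneg[OF q var_Lfun_diff[OF q g(1) mem[OF cont_h]]] by simp
    then have "AE x in M. g x - h x = 0"
      using luxemburg_eq_0_iff[OF q var_Lfun_diff[OF q g(1) mem[OF cont_h]]] by simp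
    then have "AE x in M. g x = h x" by eventually_elim simp
    then have "l = ae_class M h" unfolding g(2) by (rule ae_class_cong)
    then show "l \<in> ?C" using cont_h by (auto simp: C)
  qed
  then show ?thesis
    unfolding closed_subspace_var_L_def
  proof (intro conjI sub ballI allI)
    show "ae_class M (\<lambda>x. 0) \<in> ?C" by (auto simp: C)
    show "class_add M F G \<in> ?C" if "F \<in> ?C" "G \<in> ?C" for F G
      using that by (auto simp: C class_add_ae_class meas intro!: imageI continuous_on_add)
    show "class_scale M c F \<in> ?C" if "F \<in> ?C" for F c
      using that by (auto simp: C class_scale_ae_class meas intro!: imageI continuous_on_mult_left)
  qed
qed

text \<open>If \<open>\<bar>f\<bar> > K k\<close> at some point, then also on a nonempty open set \<open>U\<close>, and the modular of \<open>f / k\<close>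
  is at least the integral of \<open>K powr q\<close> over \<open>U\<close>, hence greater than \<open>1\<close>.\<close>
lemma dominates_sup_if_concentrated:
  fixes f q :: "real ^ 'n \<Rightarrow> real"
  defines "M \<equiv> lebesgue_on (unit_cube :: (real ^ 'n) set)"
  assumes q: "q \<in> exponents M" and K: "0 < K"
    and conc: "\<And>U. \<lbrakk>open U; U \<noteq> {}; U \<subseteq> unit_cube\<rbrakk> \<Longrightarrow> 1 < (\<integral>\<^sup>+x\<in>U. ennreal (K powr q x) \<partial>M)"
    and f: "continuous_on unit_cube f" and x: "x \<in> unit_cube"
  shows "\<bar>f x\<bar> \<le> K * luxemburg M q f"
proof (rule ccontr)
  interpret prob_space M unfolding M_def by (rule prob_space_unit_cube)
  have space: "space M = unit_cube" by (simp add: M_def)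
  assume "\<not> ?thesis"
  then have "luxemburg M q f < \<bar>f x\<bar> / K" using K by (simp add: field_simps)
  then obtain k where k: "0 < k" "k < \<bar>f x\<bar> / K" "var_modular M q (\<lambda>x. f x / k) \<le> 1"
    using luxemburg_less[OF q continuous_on_in_var_Lfun[OF q[unfolded M_def] f, folded M_def]] by blast
  define U where "U = {y \<in> box 0 1. K * k < \<bar>f y\<bar>}"
  have box_sub: "box 0 1 \<subseteq> (unit_cube :: (real ^ 'n) set)"
    unfolding unit_cube_eq_cbox by (rule box_subset_cbox)
  have "continuous_on (box 0 1) (\<lambda>y. \<bar>f y\<bar>)"
    using f box_sub by (intro continuous_on_rabs) (rule continuous_on_subset)
  then have "open (box 0 1 \<inter> (\<lambda>y. \<bar>f y\<bar>) -` {K * k<..})"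
    by (rule continuous_open_preimage) auto
  also have "box 0 1 \<inter> (\<lambda>y. \<bar>f y\<bar>) -` {K * k<..} = U" by (auto simp: U_def)
  finally have U_open: "open U" .
  have "U \<noteq> {}"
  proof
    assume empty: "U = {}"
    \<comment> \<open>The interior of the cube is dense in it, so a strict inequality at a boundary point persists inside.\<close>
    have closure: "closure (box 0 1) = (unit_cube :: (real ^ 'n) set)"
      unfolding unit_cube_eq_cbox by (rule closure_box) (simp add: interval_ne_empty_cart)
    have "\<bar>f x\<bar> \<le> K * k"
    proof (rule continuous_le_on_closure[where S = "box 0 1" and f = "\<lambda>y. \<bar>f y\<bar>"])
      show "continuous_on (closure (box 0 1)) (\<lambda>y. \<bar>f y\<bar>)" unfolding closure by (intro continuous_on_rabs f)
    qed (use x empty in \<open>auto simp: closure U_def not_less\<close>)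
    then show False using k(2) K by (simp add: field_simps)
  qed
  then have "1 < (\<integral>\<^sup>+x\<in>U. ennreal (K powr q x) \<partial>M)"
    using U_open box_sub by (intro conc) (auto simp: U_def)
  also have "\<dots> \<le> var_modular M q (\<lambda>x. f x / k)"
    unfolding var_modular_def
  proof (rule nn_integral_mono)
    fix y assume y: "y \<in> space M"
    have "K powr q y \<le> \<bar>f y / k\<bar> powr q y" if "y \<in> U"
      using that k(1) K exponent_ge1[OF q y] by (intro powr_mono2) (auto simp: U_def field_simps)
    then show "ennreal (K powr q y) * indicator U y \<le> ennreal (\<bar>f y / k\<bar> powr q y)"
      by (auto simp: indicator_def intro!: ennreal_leI)
  qed
  finally show False using k(3) by simp
qed

section \<open>The obstruction for slowly growing rearrangements\<close>
text \<open>A continuous \<open>h\<close> that agrees almost everywhere with the indicator takes both values \<open>0\<close> and \<open>1\<close>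
  in the connected interior, hence the value \<open>1/2\<close>; then it stays between \<open>1/3\<close> and \<open>2/3\<close> on a
  nonempty open set, where the indicator does not.\<close>
lemma not_ae_continuous_half_cube:
  fixes h :: "real ^ 'n \<Rightarrow> real"
  assumes h: "continuous_on unit_cube h"
  shows "\<not> (AE x in lebesgue_on unit_cube. (if 1/2 < x $ i then 1 else 0) = h x)"
proof
  assume ae: "AE x in lebesgue_on unit_cube. (if 1/2 < x $ i then 1 else 0) = h x"
  let ?B = "box 0 1 :: (real ^ 'n) set"
  have B: "?B \<subseteq> unit_cube" unfolding unit_cube_eq_cbox by (rule box_subset_cbox)
  have hB: "continuous_on ?B h" using h B by (rule continuous_on_subset)
  obtain a where a: "a \<in> ?B \<inter> {x. x $ i < 1/2}" "(if 1/2 < a $ i then 1 else 0) = h a"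
  proof (rule AE_unit_cube_open_witness[OF ae])
    show "open (?B \<inter> {x. x $ i < 1/2})" by (intro open_Int open_box open_halfspace_component_lt_cart)
    have "(\<chi> j. 1/4) \<in> ?B \<inter> {x. x $ i < 1/2}" by (simp add: mem_box_cart)
    then show "?B \<inter> {x. x $ i < 1/2} \<noteq> {}" by blast
  qed (use B in auto)
  obtain b where b: "b \<in> ?B \<inter> {x. x $ i > 1/2}" "(if 1/2 < b $ i then 1 else 0) = h b"
  proof (rule AE_unit_cube_open_witness[OF ae])
    show "open (?B \<inter> {x. x $ i > 1/2})" by (intro open_Int open_box open_halfspace_component_gt_cart)
    have "(\<chi> j. 3/4) \<in> ?B \<inter> {x. x $ i > 1/2}" by (simp add: mem_box_cart)
    then show "?B \<inter> {x. x $ i > 1/2} \<noteq> {}" by blast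
  qed (use B in auto)
  have "connected (h ` ?B)"
    by (rule connected_continuous_image[OF hB]) (simp add: convex_connected)
  moreover have "0 \<in> h ` ?B" "1 \<in> h ` ?B"
    using a b by (auto intro: rev_image_eqI[of a] rev_image_eqI[of b])
  ultimately have "{0..1} \<subseteq> h ` ?B" by (rule connected_contains_Icc)
  then have "1/2 \<in> h ` ?B" by (rule subsetD) simp
  then obtain c where c: "c \<in> ?B" "h c = 1/2" by auto
  obtain y where "y \<in> ?B \<inter> h -` {1/3<..<2/3}" "(if 1/2 < y $ i then 1 else 0) = h y"
  proof (rule AE_unit_cube_open_witness[OF ae])
    show "open (?B \<inter> h -` {1/3<..<2/3})" by (rule continuous_open_preimage[OF hB]) auto
    have "c \<in> ?B \<inter> h -` {1/3<..<2/3}" using c by simp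
    then show "?B \<inter> h -` {1/3<..<2/3} \<noteq> {}" by blast
  qed (use B in auto)
  then show False by (auto split: if_splits)
qed

text \<open>The ramps \<open>f n\<close> converge pointwise to the indicator of a half cube, and the modulars of
  \<open>(f n - g) / k\<close> are dominated by an integrable exponential of \<open>q\<close>. Dominated convergence puts the
  indicator into the closure of the continuous functions.\<close>
lemma not_closed_subspace_var_L_if_exponentials_integrable:
  fixes q :: "real ^ 'n \<Rightarrow> real"
  defines "M \<equiv> lebesgue_on (unit_cube :: (real ^ 'n) set)"
  assumes q: "q \<in> exponents M"
    and fin: "\<And>K. 1 \<le> K \<Longrightarrow> (\<integral>\<^sup>+x. ennreal (K powr q x) \<partial>M) < \<infinity>"
  shows "\<not> closed_subspace_var_L M q (continuous_classes unit_cube)"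
proof
  interpret prob_space M unfolding M_def by (rule prob_space_unit_cube)
  have space: "space M = unit_cube" by (simp add: M_def)
  interpret L: Metric_space "var_L M q" "var_L_dist M q" by (rule Metric_space_var_L[OF q])
  note [measurable] = exponent_measurable[OF q]
  assume closed: "closed_subspace_var_L M q (continuous_classes unit_cube)"
  fix i :: 'n
  define f where "f n x = max 0 (min 1 (real n * (x $ i - 1/2)))" for n and x :: "real ^ 'n"
  define g where "g x = (if 1/2 < x $ i then 1 else 0 :: real)" for x :: "real ^ 'n"
  have f_cont: "continuous_on unit_cube (f n)" for n
    unfolding f_def by (intro continuous_intros)
  note [measurable] = continuous_on_measurable_unit_cube[OF f_cont, folded M_def]
  have [measurable]: "(\<lambda>x. x $ i) \<in> borel_measurable M"
    unfolding M_def by (intro continuous_on_measurable_unit_cube continuous_intros)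
  have g_meas [measurable]: "g \<in> borel_measurable M" unfolding g_def by measurable
  have f_mem: "f n \<in> var_Lfun M q" for n
    using continuous_on_in_var_Lfun[OF q[unfolded M_def] f_cont] unfolding M_def .
  have g_mem: "g \<in> var_Lfun M q"
    by (rule bounded_in_var_Lfun[OF q g_meas, of 1]) (simp add: g_def)
  have le1: "\<bar>f n x - g x\<bar> \<le> 1" for n x by (auto simp: f_def g_def)
  have ev: "\<forall>\<^sub>F n in sequentially. f n x = g x" for x
  proof (cases "1/2 < x $ i")
    case True
    then obtain N where N: "1 < real N * (x $ i - 1/2)" using ex_less_of_nat_mult[of "x $ i - 1/2" 1] by auto
    have "f n x = g x" if "n \<ge> N" for n
    proof -
      have "real N * (x $ i - 1/2) \<le> real n * (x $ i - 1/2)" using that True by (intro mult_right_mono) auto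
      with N have "1 \<le> real n * (x $ i - 1/2)" by linarith
      then show ?thesis using True by (simp add: f_def g_def min_absorb1)
    qed
    then show ?thesis by (auto simp: eventually_sequentially)
  next
    case False
    then have "f n x = g x" for n
      by (simp add: f_def g_def max_absorb1 min.coboundedI2 mult_nonneg_nonpos)
    then show ?thesis by simp
  qed
  have conv: "(\<lambda>n. var_modular M q (\<lambda>x. (f n x - g x) / k)) \<longlonglongrightarrow> 0" if k: "0 < k" for k
  proof -
    let ?K = "max 1 (1 / k)"
    have "(\<lambda>n. \<integral>\<^sup>+x. ennreal (\<bar>(f n x - g x) / k\<bar> powr q x) \<partial>M) \<longlonglongrightarrow> (\<integral>\<^sup>+x. 0 \<partial>M)"
    proof (rule nn_integral_dominated_convergence[where w = "\<lambda>x. ennreal (?K powr q x)"])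
      show "(\<integral>\<^sup>+x. ennreal (?K powr q x) \<partial>M) < \<infinity>" by (rule fin) simp
      show "AE x in M. ennreal (\<bar>(f n x - g x) / k\<bar> powr q x) \<le> ennreal (?K powr q x)" for n
      proof (rule AE_I2)
        fix x assume x: "x \<in> space M"
        have "\<bar>(f n x - g x) / k\<bar> \<le> 1 / k" using le1[of n x] k by (simp add: abs_divide divide_right_mono)
        then have "\<bar>(f n x - g x) / k\<bar> \<le> ?K" by simp
        then show "ennreal (\<bar>(f n x - g x) / k\<bar> powr q x) \<le> ennreal (?K powr q x)"
          using exponent_ge1[OF q x] by (intro ennreal_leI powr_mono2) auto
      qed
      show "AE x in M. (\<lambda>n. ennreal (\<bar>(f n x - g x) / k\<bar> powr q x)) \<longlonglongrightarrow> 0"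
      proof (intro AE_I2 tendsto_eventually)
        show "\<forall>\<^sub>F n in sequentially. ennreal (\<bar>(f n x - g x) / k\<bar> powr q x) = 0" for x
          using ev[of x] by eventually_elim simp
      qed
    qed measurable
    then show ?thesis by (simp add: var_modular_def)
  qed
  have "limitin L.mtopology (\<lambda>n. ae_class M (f n)) (ae_class M g) sequentially"
    unfolding L.limitin_metric
  proof (intro conjI allI impI)
    show "ae_class M g \<in> var_L M q" using g_mem by (simp add: var_L_def)
    fix e :: real assume e: "0 < e"
    have "\<forall>\<^sub>F n in sequentially. var_modular M q (\<lambda>x. (f n x - g x) / (e / 2)) < 1"
      using conv[of "e / 2"] e by (intro order_tendstoD(2)) auto
    then show "\<forall>\<^sub>F n in sequentially. ae_class M (f n) \<in> var_L M q \<and>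
        var_L_dist M q (ae_class M (f n)) (ae_class M g) < e"
    proof eventually_elim
      case (elim n)
      have "luxemburg M q (\<lambda>x. f n x - g x) \<le> e / 2"
        using elim e by (intro luxemburg_le[OF q]) auto
      then show ?case
        using e f_mem[of n] by (simp add: var_L_def var_L_dist_ae_class[OF f_mem g_mem])
    qed
  qed
  moreover have "range (\<lambda>n. ae_class M (f n)) \<subseteq> continuous_classes unit_cube"
    using f_cont by (auto simp: continuous_classes_def M_def)
  ultimately have "ae_class M g \<in> continuous_classes unit_cube"
    using closed unfolding closed_subspace_var_L_def L.metric_closedin_iff_sequentially_closed by blast
  then obtain h where h: "continuous_on unit_cube h" "ae_class M g = ae_class M h"
    by (auto simp: continuous_classes_def M_def)
  then have "AE x in M. g x = h x" using ae_class_eq_iff[OF g_meas] by simp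
  then show False using not_ae_continuous_half_cube[OF h(1), of i] unfolding M_def g_def by blast
qed

text \<open>If \<open>p\<^sup>* t < ln (e / t) / L\<close> for small \<open>t\<close>, then \<open>|{p > m}| \<le> e exp (- L m)\<close> for large \<open>m\<close>. The choice
  \<open>L = ln K + 1\<close> makes the ratio \<open>exp (- L)\<close> smaller than \<open>1 / K\<close>.\<close>
lemma (in prob_space) exponentials_integrable_if_small_rearrangement:
  assumes p: "p \<in> exponents M" and q: "q \<in> equimeasurable_class M p"
    and lim: "\<not> 0 < Limsup (at_right 0) (\<lambda>t. ereal (decreasing_rearrangement M p t / ln (exp 1 / t)))"
    and K: "1 \<le> K"
  shows "(\<integral>\<^sup>+x. ennreal (K powr q x) \<partial>M) < \<infinity>"
proof -
  have qe: "q \<in> exponents M" and eq: "equimeasurable M p q" using q by (auto simp: equimeasurable_class_def)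
  note [measurable] = exponent_measurable[OF p] exponent_measurable[OF qe]
  define L where "L = ln K + 1"
  have L: "1 \<le> L" using K by (simp add: L_def)
  define \<theta> where "\<theta> = exp (- L)"
  have \<theta>: "0 < \<theta>" "\<theta> < 1" using L by (auto simp: \<theta>_def)
  have "0 < ereal (1 / L)" using L by simp
  with lim have "Limsup (at_right 0) (\<lambda>t. ereal (decreasing_rearrangement M p t / ln (exp 1 / t))) < ereal (1 / L)"
    by (simp only: not_less le_less_trans)
  then have "\<forall>\<^sub>F t in at_right 0. ereal (decreasing_rearrangement M p t / ln (exp 1 / t)) < ereal (1 / L)"
    by (rule Limsup_lessD)
  then obtain b where b: "0 < b" "\<And>t. 0 < t \<Longrightarrow> t < b \<Longrightarrow> decreasing_rearrangement M p t / ln (exp 1 / t) < 1 / L"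
    by (auto simp: eventually_at_right_field)
  have "(\<lambda>m. exp 1 * \<theta> ^ m) \<longlonglongrightarrow> 0"
    using \<theta> by (intro tendsto_mult_right_zero LIMSEQ_power_zero) auto
  then have "\<forall>\<^sub>F m in sequentially. exp 1 * \<theta> ^ m < b \<and> 0 < m"
    using b(1) by (intro eventually_conj order_tendstoD(2) eventually_gt_at_top)
  then obtain N where N: "\<And>m. m \<ge> N \<Longrightarrow> exp 1 * \<theta> ^ m < b \<and> 0 < m" by (auto simp: eventually_sequentially)
  show ?thesis
  proof (rule nn_integral_exponential_finite[where \<theta> = \<theta> and C = "exp 1" and N = N])
    show "0 < q x" if "x \<in> space M" for x using exponent_ge1[OF qe that] by simp
    have "K * \<theta> = exp (ln K + - L)" using K by (simp only: exp_add \<theta>_def) simp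
    also have "\<dots> < 1" by (simp add: L_def)
    finally show "K * \<theta> < 1" .
    fix m assume m: "m \<ge> N"
    \<comment> \<open>The \<open>t\<close> for which \<open>ln (e / t) / L\<close> equals \<open>m\<close>.\<close>
    define t where "t = exp 1 * \<theta> ^ m"
    have t: "0 < t" "t < b" using N[OF m] \<theta> by (auto simp: t_def)
    have "exp 1 / t = exp (real m * L)"
      unfolding t_def \<theta>_def by (simp add: exp_of_nat_mult[symmetric] exp_minus field_simps exp_add[symmetric])
    then have ln: "ln (exp 1 / t) = real m * L" by simp
    have "decreasing_rearrangement M p t \<le> real m"
      using b(2)[OF t] N[OF m] L unfolding ln by (simp add: field_simps)
    then have "measure M {x \<in> space M. real m < p x} \<le> t"
      using less_decreasing_rearrangement_iff[of p t "real m"] t abs_exponent_levels[OF p] by auto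
    moreover have "measure M {x \<in> space M. real m < p x} = measure M {x \<in> space M. real m < q x}"
      using eq by (simp add: equimeasurable_def measure_def)
    ultimately show "measure M {x \<in> space M. real m < q x} \<le> exp 1 * \<theta> ^ m" by (simp add: t_def)
  qed (use K \<theta> in auto)
qed

section \<open>Closedness of the continuous functions\<close>
theorem theorem2p4:
  fixes p :: "real ^ 'n \<Rightarrow> real"
  assumes "p \<in> exponents (lebesgue_on unit_cube)"
  shows "(\<exists>q \<in> equimeasurable_class (lebesgue_on unit_cube) p.
            closed_subspace_var_L (lebesgue_on unit_cube) q (continuous_classes unit_cube)) \<longleftrightarrow>
         0 < Limsup (at_right 0)
           (\<lambda>t. ereal (decreasing_rearrangement (lebesgue_on unit_cube) p t / ln (exp 1 / t)))"
    (is "?closed \<longleftrightarrow> ?large")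
proof
  interpret prob_space "lebesgue_on (unit_cube :: (real ^ 'n) set)" by (rule prob_space_unit_cube)
  assume ?closed
  then obtain q where q: "q \<in> equimeasurable_class (lebesgue_on unit_cube) p"
    and closed: "closed_subspace_var_L (lebesgue_on unit_cube) q (continuous_classes unit_cube)" by blast
  have qe: "q \<in> exponents (lebesgue_on unit_cube)" using q by (simp add: equimeasurable_class_def)
  show ?large
  proof (rule ccontr)
    assume "\<not> ?large"
    note exponentials_integrable_if_small_rearrangement[OF assms q this]
    then show False
      using not_closed_subspace_var_L_if_exponentials_integrable[OF qe] closed by blast
  qed
next
  assume ?large
  then obtain q K where q: "q \<in> equimeasurable_class (lebesgue_on unit_cube) p" and K: "0 < K"
    and conc: "\<And>U. \<lbrakk>open U; U \<noteq> {}; U \<subseteq> unit_cube\<rbrakk> \<Longrightarrow>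
      1 < (\<integral>\<^sup>+x\<in>U. ennreal (K powr q x) \<partial>lebesgue_on unit_cube)"
    by (rule obtain_concentrated_exponent[OF assms]) (rule that, assumption+)
  have qe: "q \<in> exponents (lebesgue_on unit_cube)" using q by (simp add: equimeasurable_class_def)
  have "closed_subspace_var_L (lebesgue_on unit_cube) q (continuous_classes unit_cube)"
    by (rule closed_subspace_var_L_if_dominates_sup[OF qe K])
      (rule dominates_sup_if_concentrated[OF qe K conc])
  with q show ?closed by blast
qed

end
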